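(* Let $u_0,u_1\in\mathrm{PSH}^-(D)$ be such that, for $j=0,1$, the set $A_j=\{z:u_j(z)=-\infty\}$ is closed in $D$ and $u_j$ is locally bounded on $D\setminus A_j$. Let $P=P(g_{u_0},g_{u_1})$. If $\Phi\in\mathrm{PSH}^-(D\times S)$ satisfies $$\limsup_{(x,\zeta)\to(z,\zeta_0)}\Phi(x,\zeta)\le u_j(z)\quad\text{for all }z\in D,\ \zeta_0\in S_j,\ j=0,1,$$ then $\Phi(z,\zeta)\le P(z)$ for all $z\in D$, $\zeta\in S$. In particular, if $u_j=g_{u_j}$ for $j=0,1$, then the largest $\Phi\in\mathrm{PSH}^-(D\times S)$ satisfying this condition is $\Phi(z,\zeta)=P(z)$ (independent of $\zeta$).
   Context: $D\subset\mathbb C^n$ is a bounded hyperconvex domain; $\mathrm{PSH}^-(\Omega)$ denotes the nonpositive plurisubharmonic functions on $\Omega$. $S=\{\zeta\in\mathbb C:1<|\zeta|<e\}$, $S_0=\{|\zeta|=1\}$, $S_1=\{|\zeta|=e\}$. For $u\in\mathrm{PSH}^-(D)$, $g_u(z)=\limsup_{x\to z}\sup\{v(x):v\in\mathrm{PSH}^-(D),\ v\le u+O(1)\}$ (i.e. $v\le u+c_v$ on $D$ for some constant $c_v$). For plurisubharmonic $u,v$ on $D$, $P(u,v)$ denotes the largest plurisubharmonic function on $D$ that is $\le\min\{u,v\}$. *)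

theory Defs
  imports "HOL-Analysis.Analysis"
begin

text \<open>Functions take values in the extended reals; plurisubharmonic functions
take values in [-infinity, infinity).  Functions are defined on the whole type,
only their values on the relevant domain matter.\<close>

definition usc_on :: "'a::topological_space set \<Rightarrow> ('a \<Rightarrow> ereal) \<Rightarrow> bool" where
  "usc_on U f \<longleftrightarrow> (\<forall>c::ereal. openin (top_of_set U) {z\<in>U. f z < c})"

text \<open>Subharmonic on an open set U of the plane: upper semicontinuous, never
+infinity, and satisfying the sub-mean-value inequality on every closed disc in U.
The circle mean of the (usc, bounded above) function v is expressed through
continuous real majorants h of v on the circle.\<close>

definition subharmonic_on :: "(complex \<Rightarrow> ereal) \<Rightarrow> complex set \<Rightarrow> bool" where
  "subharmonic_on v U \<longleftrightarrow> open U \<and> usc_on U v \<and> (\<forall>w\<in>U. v w < \<infinity>) \<and>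
     (\<forall>w r. r > 0 \<and> cball w r \<subseteq> U \<longrightarrow>
        (\<forall>h::complex \<Rightarrow> real. continuous_on (sphere w r) h \<and>
            (\<forall>t\<in>sphere w r. v t \<le> ereal (h t)) \<longrightarrow>
            v w \<le> ereal ((1 / (2 * pi)) *
                     integral {0..2*pi} (\<lambda>t. h (w + complex_of_real r * cis t)))))"

text \<open>Plurisubharmonic on an open set: usc, and subharmonic on every complex line.
The complex scalar multiplication of the ambient space is given as parameter sc.\<close>

definition psh_gen :: "(complex \<Rightarrow> 'a \<Rightarrow> 'a) \<Rightarrow> ('a::real_normed_vector \<Rightarrow> ereal) \<Rightarrow> 'a set \<Rightarrow> bool" where
  "psh_gen sc u \<Omega> \<longleftrightarrow> open \<Omega> \<and> usc_on \<Omega> u \<and> (\<forall>z\<in>\<Omega>. u z < \<infinity>) \<and>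
     (\<forall>z0\<in>\<Omega>. \<forall>a. subharmonic_on (\<lambda>w. u (z0 + sc w a)) {w. z0 + sc w a \<in> \<Omega>})"

definition psh :: "(complex^'n \<Rightarrow> ereal) \<Rightarrow> (complex^'n) set \<Rightarrow> bool" where
  "psh u \<Omega> \<longleftrightarrow> psh_gen (\<lambda>w a. w *s a) u \<Omega>"

definition psh2 :: "((complex^'n) \<times> complex \<Rightarrow> ereal) \<Rightarrow> ((complex^'n) \<times> complex) set \<Rightarrow> bool" where
  "psh2 u \<Omega> \<longleftrightarrow> psh_gen (\<lambda>w a. (w *s fst a, w * snd a)) u \<Omega>"

definition PSHneg :: "(complex^'n) set \<Rightarrow> (complex^'n \<Rightarrow> ereal) set" where
  "PSHneg \<Omega> = {u. psh u \<Omega> \<and> (\<forall>z\<in>\<Omega>. u z \<le> 0)}"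

definition PSHneg2 :: "((complex^'n) \<times> complex) set \<Rightarrow> ((complex^'n) \<times> complex \<Rightarrow> ereal) set" where
  "PSHneg2 \<Omega> = {u. psh2 u \<Omega> \<and> (\<forall>z\<in>\<Omega>. u z \<le> 0)}"

definition hyperconvex :: "(complex^'n) set \<Rightarrow> bool" where
  "hyperconvex D \<longleftrightarrow> bounded D \<and> open D \<and> connected D \<and> D \<noteq> {} \<and>
     (\<exists>\<rho>. psh \<rho> D \<and> (\<forall>z\<in>D. \<rho> z < 0) \<and>
        (\<forall>c::real. c < 0 \<longrightarrow> compact (closure {z\<in>D. \<rho> z < ereal c})
                              \<and> closure {z\<in>D. \<rho> z < ereal c} \<subseteq> D))"

definition annS :: "complex set" where
  "annS = {\<zeta>. 1 < cmod \<zeta> \<and> cmod \<zeta> < exp 1}"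

definition S0 :: "complex set" where "S0 = sphere 0 1"
definition S1 :: "complex set" where "S1 = sphere 0 (exp 1)"

text \<open>g_u(z) = limsup_{x->z} sup{v(x) : v in PSH^-(D), v <= u + O(1)}
(the limsup includes x = z, i.e. upper semicontinuous regularization).\<close>

definition g_env :: "(complex^'n) set \<Rightarrow> (complex^'n \<Rightarrow> ereal) \<Rightarrow> complex^'n \<Rightarrow> ereal" where
  "g_env D u z = Limsup (nhds z)
     (\<lambda>x. Sup {v x | v. v \<in> PSHneg D \<and> (\<exists>c::real. \<forall>y\<in>D. v y \<le> u y + ereal c)})"

text \<open>P(u,v): the largest psh function on D that is <= min{u,v}, realized as the
usc regularization of the upper envelope of all such psh functions.\<close>

definition P_env :: "(complex^'n) set \<Rightarrow> (complex^'n \<Rightarrow> ereal) \<Rightarrow> (complex^'n \<Rightarrow> ereal) \<Rightarrow> complex^'n \<Rightarrow> ereal" where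
  "P_env D u v z = Limsup (nhds z)
     (\<lambda>x. Sup {w x | w. psh w D \<and> (\<forall>y\<in>D. w y \<le> min (u y) (v y))})"

definition bdry_cond :: "(complex^'n) set \<Rightarrow> (complex^'n \<Rightarrow> ereal) \<Rightarrow> (complex^'n \<Rightarrow> ereal)
     \<Rightarrow> ((complex^'n) \<times> complex \<Rightarrow> ereal) \<Rightarrow> bool" where
  "bdry_cond D u0 u1 \<Phi> \<longleftrightarrow>
     (\<forall>z\<in>D. \<forall>\<zeta>0\<in>S0. Limsup (at (z, \<zeta>0) within D \<times> annS) \<Phi> \<le> u0 z) \<and>
     (\<forall>z\<in>D. \<forall>\<zeta>0\<in>S1. Limsup (at (z, \<zeta>0) within D \<times> annS) \<Phi> \<le> u1 z)"

definition pole_set :: "(complex^'n) set \<Rightarrow> (complex^'n \<Rightarrow> ereal) \<Rightarrow> (complex^'n) set" where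
  "pole_set D u = {z\<in>D. u z = -\<infinity>}"

definition locally_bounded_on :: "(complex^'n) set \<Rightarrow> (complex^'n \<Rightarrow> ereal) \<Rightarrow> bool" where
  "locally_bounded_on U u \<longleftrightarrow>
     (\<forall>z\<in>U. \<exists>r>0. \<exists>M::real. \<forall>x\<in>ball z r \<inter> U. \<bar>u x\<bar> \<le> ereal M)"

end

theory Submission
  imports Defs "HOL-Complex_Analysis.Complex_Analysis"
begin

text \<open>The supremum of \<open>\<Phi>\<close> over rotations of \<open>\<zeta>\<close> is a plurisubharmonic function
  \<open>\<Psi>(z, e\<^sup>t)\<close> of \<open>t = ln \<bar>\<zeta>\<bar>\<close> that is convex in \<open>t\<close>.  Its partial Legendre transform
  \<open>w\<^sub>c(z) = inf\<^sub>t (\<Psi>(z, e\<^sup>t) - c t)\<close> is plurisubharmonic by Kiselev's minimum principle, and the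
  boundary condition gives \<open>w\<^sub>c \<le> u\<^sub>0\<close> and \<open>w\<^sub>c \<le> u\<^sub>1 - c\<close>.  Hence \<open>W = w\<^sub>c + max c 0\<close> is
  nonpositive and bounded by \<open>u\<^sub>j + O(1)\<close> for both \<open>j\<close>, so \<open>W \<le> P\<close>.  If \<open>c\<close> is a slope of a
  supporting line at \<open>t\<close>, then \<open>\<Psi>(z, e\<^sup>t) = w\<^sub>c(z) + c t \<le> W(z)\<close>.

  For the minimum principle, convexity in \<open>t\<close> allows near-minimisers to be chosen continuously on
  a circle, and then as \<open>Re q\<close> with \<open>q\<close> entire; this reduces the claim to the sub-mean-value
  property of \<open>\<Psi>\<close> on the holomorphic disc \<open>w \<mapsto> (z + w a, exp (q w))\<close>.  As plurisubharmonicity is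
  only given on complex lines, that property is obtained by adding \<open>\<eta> \<bar>w\<bar>\<^sup>2\<close>, penalising the squared
  distance to the disc, and restricting to the tangent line at an interior maximum point: along
  it the penalty is harmonic up to fourth order.\<close>

section \<open>Upper semicontinuous functions\<close>

lemma usc_on_iff:
  "usc_on U f \<longleftrightarrow>
    (\<forall>x\<in>U. \<forall>c. f x < c \<longrightarrow> (\<exists>V. open V \<and> x \<in> V \<and> (\<forall>y\<in>U\<inter>V. f y < c)))"
proof
  assume u: "usc_on U f"
  show "\<forall>x\<in>U. \<forall>c. f x < c \<longrightarrow> (\<exists>V. open V \<and> x \<in> V \<and> (\<forall>y\<in>U\<inter>V. f y < c))"
  proof (intro ballI allI impI)
    fix x c assume "x \<in> U" "f x < c"
    moreover obtain V where "open V" "{z\<in>U. f z < c} = U \<inter> V"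
      using u unfolding usc_on_def openin_open by blast
    ultimately show "\<exists>V. open V \<and> x \<in> V \<and> (\<forall>y\<in>U\<inter>V. f y < c)"
      by (intro exI[of _ V]) blast
  qed
next
  assume *: "\<forall>x\<in>U. \<forall>c. f x < c \<longrightarrow> (\<exists>V. open V \<and> x \<in> V \<and> (\<forall>y\<in>U\<inter>V. f y < c))"
  show "usc_on U f"
    unfolding usc_on_def
  proof (intro allI)
    fix c
    show "openin (top_of_set U) {z\<in>U. f z < c}"
    proof (subst openin_subopen, intro ballI)
      fix x assume "x \<in> {z\<in>U. f z < c}"
      then obtain V where "open V" "x \<in> V" "\<forall>y\<in>U\<inter>V. f y < c" "x \<in> U"
        using * by blast
      then show "\<exists>T. openin (top_of_set U) T \<and> x \<in> T \<and> T \<subseteq> {z\<in>U. f z < c}"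
        by (intro exI[of _ "U \<inter> V"]) (auto simp: openin_open)
    qed
  qed
qed

lemma usc_on_openD: "usc_on U f \<Longrightarrow> open U \<Longrightarrow> open {z\<in>U. f z < c}"
  unfolding usc_on_def by (meson openin_open_trans)

lemma usc_on_compose:
  assumes "usc_on U f" "continuous_on S \<phi>" "\<phi> ` S \<subseteq> U"
  shows "usc_on S (\<lambda>x. f (\<phi> x))"
  unfolding usc_on_def
proof
  fix c
  have "{z\<in>S. f (\<phi> z) < c} = S \<inter> \<phi> -` {z\<in>U. f z < c}"
    using assms(3) by auto
  moreover have "openin (top_of_set S) (S \<inter> \<phi> -` {z\<in>U. f z < c})"
    using assms unfolding usc_on_def
    by (intro continuous_openin_preimage[where T=U]) auto
  ultimately show "openin (top_of_set S) {z\<in>S. f (\<phi> z) < c}" by simp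
qed

lemma ereal_add_real_less_iff: "x + ereal a < c \<longleftrightarrow> x < c - ereal a"
  by (cases x; cases c) auto

lemma ereal_add_real_le_iff: "x + ereal a \<le> c \<longleftrightarrow> x \<le> c - ereal a"
  by (cases x; cases c) auto

lemma usc_on_add_continuous:
  assumes f: "usc_on U f" and g: "continuous_on U g"
  shows "usc_on U (\<lambda>x. f x + ereal (g x))"
  unfolding usc_on_iff
proof (intro ballI allI impI)
  fix x c assume x: "x \<in> U" and less: "f x + ereal (g x) < c"
  then have "f x < c - ereal (g x)" by (simp add: ereal_add_real_less_iff)
  \<comment> \<open>The real \<open>d\<close> splits the gap even when \<open>f x\<close> is minus
    infinity; the second real \<open>e\<close> leaves the positive slack \<open>e - d - g x\<close>
    for the variation of \<open>g\<close>.\<close>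
  then obtain d where d: "f x < ereal d" "ereal d < c - ereal (g x)"
    using ereal_dense2 by blast
  then have "ereal (d + g x) < c"
    by (cases c) auto
  then obtain e where e: "ereal (d + g x) < ereal e" "ereal e < c"
    using ereal_dense2 by blast
  obtain V where V: "open V" "x \<in> V" "\<forall>y\<in>U\<inter>V. f y < ereal d"
    using f x d(1) unfolding usc_on_iff by blast
  have "g x < e - d" using e by simp
  then obtain W where W: "open W" "x \<in> W" "\<forall>y\<in>U\<inter>W. g y < e - d"
    using g x unfolding continuous_on_topological
    by (metis IntD1 IntD2 lessThan_iff open_lessThan)
  have "f y + ereal (g y) < c" if "y \<in> U \<inter> (V \<inter> W)" for y
  proof -
    have "f y + ereal (g y) \<le> ereal d + ereal (e - d)"
      using V W that by (intro add_mono) (auto intro: less_imp_le)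
    then show ?thesis using e by simp
  qed
  then show "\<exists>V. open V \<and> x \<in> V \<and> (\<forall>y\<in>U\<inter>V. f y + ereal (g y) < c)"
    using V W by (intro exI[of _ "V \<inter> W"]) auto
qed

text \<open>If no maximum existed, the relatively open sets where \<open>f\<close> lies below a
  larger value \<open>f (m x)\<close> would cover \<open>K\<close>; the largest of finitely many
  such values would then have to exceed itself.\<close>

lemma usc_on_attains_sup:
  fixes f :: "'a::topological_space \<Rightarrow> ereal"
  assumes f: "usc_on K f" and K: "compact K" "K \<noteq> {}"
  shows "\<exists>x\<in>K. \<forall>y\<in>K. f y \<le> f x"
proof (rule ccontr)
  assume "\<not> ?thesis"
  then have "\<forall>x\<in>K. \<exists>y\<in>K. f x < f y" by (auto simp: not_le)
  then obtain m where m: "\<And>x. x \<in> K \<Longrightarrow> m x \<in> K \<and> f x < f (m x)" by metis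
  then have "\<forall>x\<in>K. \<exists>V. open V \<and> x \<in> V \<and> (\<forall>y\<in>K\<inter>V. f y < f (m x))"
    using f unfolding usc_on_iff by blast
  then obtain V where V: "\<And>x. x \<in> K \<Longrightarrow> open (V x) \<and> x \<in> V x \<and> (\<forall>y\<in>K\<inter>V x. f y < f (m x))"
    by metis
  obtain F where F: "F \<subseteq> K" "finite F" "K \<subseteq> (\<Union>x\<in>F. V x)"
    using compactE_image[OF K(1), of K V] V by blast
  then have "F \<noteq> {}" using K by auto
  have "Max ((\<lambda>x. f (m x)) ` F) \<in> (\<lambda>x. f (m x)) ` F"
    using F \<open>F \<noteq> {}\<close> by (intro Max_in) auto
  then obtain x where x: "x \<in> F" "f (m x) = Max ((\<lambda>x. f (m x)) ` F)" by auto
  then obtain x' where x': "x' \<in> F" "m x \<in> V x'"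
    using F m by blast
  then have "f (m x) < f (m x')" using V F x m by blast
  also have "\<dots> \<le> f (m x)" using x x' F by simp
  finally show False by simp
qed

text \<open>Attainment turns a strict bound on every \<open>f (x, k)\<close> into a strict bound on
  the supremum; the tube lemma makes the bounds persist for all \<open>k\<close> at once when
  \<open>x\<close> moves.\<close>

lemma usc_on_SUP_compact:
  fixes f :: "'a::topological_space \<times> 'b::topological_space \<Rightarrow> ereal"
  assumes f: "usc_on (X \<times> K) f" and K: "compact K" "K \<noteq> {}"
  shows usc_on_SUP_compact_usc: "usc_on X (\<lambda>x. SUP k\<in>K. f (x, k))"
    and usc_on_SUP_compact_attained: "\<And>x. x \<in> X \<Longrightarrow> \<exists>k\<in>K. (SUP k\<in>K. f (x, k)) = f (x, k)"
proof -
  show att: "\<exists>k\<in>K. (SUP k\<in>K. f (x, k)) = f (x, k)" if "x \<in> X" for x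
  proof -
    have "usc_on K (\<lambda>k. f (x, k))"
      using that by (intro usc_on_compose[OF f]) (auto intro!: continuous_intros)
    from usc_on_attains_sup[OF this K] obtain k
      where "k \<in> K" "\<forall>y\<in>K. f (x, y) \<le> f (x, k)" by blast
    then show ?thesis
      by (intro bexI[of _ k] antisym SUP_least SUP_upper) auto
  qed
  show "usc_on X (\<lambda>x. SUP k\<in>K. f (x, k))"
    unfolding usc_on_iff
  proof (intro ballI allI impI)
    fix x c assume x: "x \<in> X" and less: "(SUP k\<in>K. f (x, k)) < c"
    obtain W where W: "open W" "{z\<in>X\<times>K. f z < c} = (X \<times> K) \<inter> W"
      using f unfolding usc_on_def openin_open by blast
    have "f (x, k) < c" if "k \<in> K" for k
      using less that by (meson SUP_upper le_less_trans)
    then have "{x} \<times> K \<subseteq> W" using W(2) x by blast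
    then obtain X0 where X0: "x \<in> X0" "open X0" "X0 \<times> K \<subseteq> W"
      using Elementary_Topology.tube_lemma[OF K(1) W(1), of x] by blast
    have "(SUP k\<in>K. f (y, k)) < c" if "y \<in> X \<inter> X0" for y
    proof -
      obtain k where "k \<in> K" "(SUP k\<in>K. f (y, k)) = f (y, k)"
        using att \<open>y \<in> X \<inter> X0\<close> by blast
      moreover have "(y, k) \<in> {z\<in>X\<times>K. f z < c}"
        unfolding W(2) using X0 that \<open>k \<in> K\<close> by blast
      ultimately show ?thesis by auto
    qed
    then show "\<exists>V. open V \<and> x \<in> V \<and> (\<forall>y\<in>X\<inter>V. (SUP k\<in>K. f (y, k)) < c)"
      using X0 by blast
  qed
qed

section \<open>Circle means and touching from above\<close>

text \<open>Cauchy's integral formula in the angle variable: on the circle,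
  \<open>du / (u - z)\<close> is \<open>\<i> dt\<close>.\<close>

lemma circle_mean_holomorphic:
  assumes r: "r > 0" and f: "f holomorphic_on S" "open S" "cball z r \<subseteq> S"
  shows "((\<lambda>t. f (z + of_real r * cis t)) has_integral (of_real (2*pi) * f z)) {0..2*pi}"
proof -
  have "((\<lambda>u. f u / (u - z)) has_contour_integral (2 * of_real pi * \<i> * f z)) (circlepath z r)"
    using assms holomorphic_on_subset[OF f(1) f(3)]
    by (intro Cauchy_integral_circlepath)
      (auto intro: holomorphic_on_subset[of f "cball z r"] holomorphic_on_imp_continuous_on)
  then have "((\<lambda>u. f u / (u - z)) has_contour_integral (2 * of_real pi * \<i> * f z))
      (part_circlepath z r 0 (2*pi))"
    by (simp add: circlepath_def)
  then have "((\<lambda>t. f (z + r * cis t) / (r * cis t) * r * \<i> * cis t) has_integral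
      (2 * of_real pi * \<i> * f z)) {0..2*pi}"
    by (subst (asm) has_contour_integral_part_circlepath_iff) auto
  then have "((\<lambda>t. (1/\<i>) * (f (z + r * cis t) / (r * cis t) * r * \<i> * cis t)) has_integral
      (1/\<i>) * (2 * of_real pi * \<i> * f z)) {0..2*pi}"
    by (rule has_integral_mult_right)
  then show ?thesis
    using r by (simp add: field_simps)
qed

lemma circle_mean_Re:
  assumes r: "r > 0" and f: "f holomorphic_on S" "open S" "cball z r \<subseteq> S"
  shows "((\<lambda>t. Re (f (z + of_real r * cis t))) has_integral (2*pi * Re (f z))) {0..2*pi}"
  using has_integral_Re[OF circle_mean_holomorphic[OF assms]] by simp

lemma continuous_on_complex_line [continuous_intros]:
  fixes a :: "complex^'n"
  shows "continuous_on S f \<Longrightarrow> continuous_on S (\<lambda>x. f x *s a)"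
  unfolding vector_scalar_mult_def by (intro continuous_intros)

section \<open>Sub-mean-value inequalities on complex lines\<close>

lemma psh_gen_submean:
  assumes "psh_gen sc u \<Omega>" "z0 \<in> \<Omega>" "0 < r" "\<And>w. w \<in> cball w0 r \<Longrightarrow> z0 + sc w a \<in> \<Omega>"
    and "continuous_on (sphere w0 r) h" "\<And>w. w \<in> sphere w0 r \<Longrightarrow> u (z0 + sc w a) \<le> ereal (h w)"
  shows "u (z0 + sc w0 a) \<le>
    ereal (1 / (2*pi) * integral {0..2*pi} (\<lambda>t. h (w0 + complex_of_real r * cis t)))"
proof -
  have sub: "subharmonic_on (\<lambda>w. u (z0 + sc w a)) {w. z0 + sc w a \<in> \<Omega>}"
    using assms(1,2) unfolding psh_gen_def by blast
  have "w0 \<in> {w. z0 + sc w a \<in> \<Omega>}" using assms(3) assms(4)[of w0] by simp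
  moreover have "cball w0 r \<subseteq> {w. z0 + sc w a \<in> \<Omega>}" using assms(4) by blast
  ultimately show ?thesis
    using sub assms(3,5,6) unfolding subharmonic_on_def by blast
qed

text \<open>Continuity of the line map supplies openness and upper semicontinuity of every
  restriction, so only one inequality per closed disc remains. Leaving \<open>sc\<close> abstract
  serves both \<open>psh\<close> and \<open>psh2\<close>.\<close>

lemma psh_genI:
  assumes "open \<Omega>" and usc: "usc_on \<Omega> u" and fin: "\<And>z. z \<in> \<Omega> \<Longrightarrow> u z < \<infinity>"
    and line: "\<And>z0 a. continuous_on UNIV (\<lambda>w. z0 + sc w a)"
    and sub: "\<And>z0 a w0 r h. \<lbrakk>z0 \<in> \<Omega>; 0 < r; \<And>w. w \<in> cball w0 r \<Longrightarrow> z0 + sc w a \<in> \<Omega>;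
          continuous_on (sphere w0 r) h;
          \<And>w. w \<in> sphere w0 r \<Longrightarrow> u (z0 + sc w a) \<le> ereal (h w)\<rbrakk>
        \<Longrightarrow> u (z0 + sc w0 a) \<le>
          ereal (1 / (2*pi) * integral {0..2*pi} (\<lambda>t. h (w0 + complex_of_real r * cis t)))"
  shows "psh_gen sc u \<Omega>"
  unfolding psh_gen_def
proof (intro conjI ballI allI)
  fix z0 a assume z0: "z0 \<in> \<Omega>"
  define T where "T = {w. z0 + sc w a \<in> \<Omega>}"
  have "open ((\<lambda>w. z0 + sc w a) -` \<Omega>)"
    using \<open>open \<Omega>\<close> line continuous_open_vimage continuous_on_eq_continuous_at[OF open_UNIV]
    by (metis UNIV_I)
  then have "open T" by (simp add: T_def vimage_def)
  have "usc_on T (\<lambda>w. u (z0 + sc w a))"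
    by (rule usc_on_compose[OF usc]) (auto simp: T_def intro: continuous_on_subset[OF line])
  then show "subharmonic_on (\<lambda>w. u (z0 + sc w a)) {w. z0 + sc w a \<in> \<Omega>}"
    unfolding subharmonic_on_def T_def[symmetric]
  proof (intro conjI ballI allI impI)
    show "u (z0 + sc w a) < \<infinity>" if "w \<in> T" for w using that fin by (simp add: T_def)
    show "u (z0 + sc w a) \<le> ereal (1 / (2*pi) *
        integral {0..2*pi} (\<lambda>t. h (w + complex_of_real r * cis t)))"
      if "0 < r \<and> cball w r \<subseteq> T"
        "continuous_on (sphere w r) h \<and> (\<forall>t\<in>sphere w r. u (z0 + sc t a) \<le> ereal (h t))" for w r h
      using that by (intro sub[OF z0]) (auto simp: T_def)
  qed (use \<open>open T\<close> in auto)
qed (use assms in auto)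

text \<open>The circle mean of the majorant at radius \<open>r\<close> is
  \<open>Re (g 0) - \<eta> r^2 + C r^4\<close>, which for small \<open>r\<close> is below the value
  at the centre. The quartic term leaves room for penalties that are harmonic only up to fourth
  order.\<close>

lemma psh_gen_no_touching:
  assumes psh: "psh_gen sc u \<Omega>" and p: "p \<in> \<Omega>" and sc0: "sc 0 a = 0"
    and g: "g holomorphic_on ball 0 \<rho>" and pos: "0 < \<rho>" "0 < \<eta>" "0 \<le> C"
    and dom: "\<And>s. s \<in> ball 0 \<rho> \<Longrightarrow> p + sc s a \<in> \<Omega>"
    and le: "\<And>s. s \<in> ball 0 \<rho> \<Longrightarrow>
        u (p + sc s a) \<le> ereal (Re (g s) - \<eta> * cmod s ^ 2 + C * cmod s ^ 4)"
    and eq: "u p = ereal (Re (g 0))"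
  shows False
proof -
  \<comment> \<open>The second bound forces \<open>C * r^2 < \<eta>\<close>; \<open>C + 1\<close>
    keeps the denominator positive when \<open>C = 0\<close>.\<close>
  define r where "r = min (\<rho>/2) (sqrt (\<eta> / (2*(C+1))))"
  have r: "0 < r" "r < \<rho>" using pos by (auto simp: r_def)
  have "r^2 \<le> \<eta> / (2*(C+1))"
    using r pos unfolding r_def by (metis abs_of_pos min.cobounded2 real_sqrt_le_iff real_sqrt_abs)
  then have "C * r^2 \<le> C * (\<eta> / (2*(C+1)))" using pos by (intro mult_left_mono) auto
  also have "\<dots> < \<eta>" using pos by (simp add: field_simps) (simp add: add_nonneg_pos)
  finally have "r^2 * (C * r^2) < r^2 * \<eta>" using r by (intro mult_strict_left_mono) auto
  then have neg: "- \<eta> * r^2 + C * r^4 < 0"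
    by (simp add: algebra_simps power2_eq_square power4_eq_xxxx)
  define k where "k = - \<eta> * r^2 + C * r^4"
  have sub: "cball 0 r \<subseteq> ball 0 \<rho>" using r by auto
  have "u (p + sc 0 a) \<le> ereal (1 / (2*pi) *
      integral {0..2*pi} (\<lambda>t. Re (g (0 + complex_of_real r * cis t)) + k))"
  proof (rule psh_gen_submean[OF psh p r(1)])
    show "p + sc w a \<in> \<Omega>" if "w \<in> cball 0 r" for w using dom that sub by blast
    have "continuous_on (sphere 0 r) g"
      using g r by (intro holomorphic_on_imp_continuous_on holomorphic_on_subset[OF g]) auto
    then show "continuous_on (sphere 0 r) (\<lambda>w. Re (g w) + k)"
      by (intro continuous_intros)
    show "u (p + sc w a) \<le> ereal (Re (g w) + k)" if "w \<in> sphere 0 r" for w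
      using le[of w] that r by (simp add: k_def algebra_simps)
  qed
  also have "integral {0..2*pi} (\<lambda>t. Re (g (0 + complex_of_real r * cis t)) + k) =
      2*pi * Re (g 0) + 2*pi*k"
    using has_integral_add[OF circle_mean_Re[OF r(1) g open_ball sub]
        has_integral_const_real[of k 0 "2*pi"]] by (intro integral_unique) simp
  also have "1 / (2*pi) * (2*pi * Re (g 0) + 2*pi*k) = Re (g 0) + k"
    by (simp add: field_simps)
  finally show False using eq sc0 neg by (simp add: k_def)
qed

section \<open>The product of \<open>D\<close> with the annulus\<close>

abbreviation sc2 :: "complex \<Rightarrow> (complex^'n) \<times> complex \<Rightarrow> (complex^'n) \<times> complex" where
  "sc2 w a \<equiv> (w *s fst a, w * snd a)"

lemma open_annS: "open annS"
proof -
  have "annS = ball 0 (exp 1) - cball 0 1" by (auto simp: annS_def)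
  then show ?thesis by (metis open_Diff open_ball closed_cball)
qed

lemma annS_nonzero: "\<zeta> \<in> annS \<Longrightarrow> \<zeta> \<noteq> 0" by (auto simp: annS_def)

lemma psh2_usc: "psh2 u \<Omega> \<Longrightarrow> usc_on \<Omega> u" and psh2_open: "psh2 u \<Omega> \<Longrightarrow> open \<Omega>"
  and psh2_less_PInf: "psh2 u \<Omega> \<Longrightarrow> z \<in> \<Omega> \<Longrightarrow> u z < \<infinity>"
  by (simp_all add: psh2_def psh_gen_def)

lemma psh2I:
  fixes u :: "(complex^'n) \<times> complex \<Rightarrow> ereal"
  assumes "open \<Omega>" and "usc_on \<Omega> u" and "\<And>z. z \<in> \<Omega> \<Longrightarrow> u z < \<infinity>"
    and "\<And>z0 \<zeta>0 a b w0 r h. \<lbrakk>(z0, \<zeta>0) \<in> \<Omega>; 0 < r;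
          \<And>w. w \<in> cball w0 r \<Longrightarrow> (z0 + w *s a, \<zeta>0 + w * b) \<in> \<Omega>;
          continuous_on (sphere w0 r) h;
          \<And>w. w \<in> sphere w0 r \<Longrightarrow> u (z0 + w *s a, \<zeta>0 + w * b) \<le> ereal (h w)\<rbrakk>
        \<Longrightarrow> u (z0 + w0 *s a, \<zeta>0 + w0 * b) \<le>
          ereal (1 / (2*pi) * integral {0..2*pi} (\<lambda>t. h (w0 + complex_of_real r * cis t)))"
  shows "psh2 u \<Omega>"
  unfolding psh2_def
proof (rule psh_genI[OF assms(1-3)])
  show "continuous_on UNIV (\<lambda>w. z0 + (w *s fst a, w * snd a))"
    for z0 a :: "(complex^'n) \<times> complex"
    by (intro continuous_intros)
next
  fix z0 a :: "(complex^'n) \<times> complex" and w0 r h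
  assume "z0 \<in> \<Omega>" "0 < r" "\<And>w. w \<in> cball w0 r \<Longrightarrow> z0 + sc2 w a \<in> \<Omega>"
    "continuous_on (sphere w0 r) h" "\<And>w. w \<in> sphere w0 r \<Longrightarrow> u (z0 + sc2 w a) \<le> ereal (h w)"
  then show "u (z0 + sc2 w0 a) \<le>
      ereal (1 / (2*pi) * integral {0..2*pi} (\<lambda>t. h (w0 + complex_of_real r * cis t)))"
    using assms(4)[of "fst z0" "snd z0" r w0 "fst a" "snd a" h]
    by (simp add: plus_prod_def)
qed auto

lemma psh2_submean:
  assumes "psh2 u \<Omega>" "(z0, \<zeta>0) \<in> \<Omega>" "0 < r"
    "\<And>w. w \<in> cball w0 r \<Longrightarrow> (z0 + w *s a, \<zeta>0 + w * b) \<in> \<Omega>"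
    "continuous_on (sphere w0 r) h"
    "\<And>w. w \<in> sphere w0 r \<Longrightarrow> u (z0 + w *s a, \<zeta>0 + w * b) \<le> ereal (h w)"
  shows "u (z0 + w0 *s a, \<zeta>0 + w0 * b) \<le>
    ereal (1 / (2*pi) * integral {0..2*pi} (\<lambda>t. h (w0 + complex_of_real r * cis t)))"
  using psh_gen_submean[OF assms(1)[unfolded psh2_def] assms(2,3), of w0 "(a, b)" h] assms(4-6)
  by simp

lemma psh2_no_touching:
  assumes psh: "psh2 u \<Omega>" and p: "(z, \<zeta>) \<in> \<Omega>"
    and g: "g holomorphic_on ball 0 \<rho>" and pos: "0 < \<rho>" "0 < \<eta>" "0 \<le> C"
    and dom: "\<And>s. s \<in> ball 0 \<rho> \<Longrightarrow> (z + s *s a, \<zeta> + s * b) \<in> \<Omega>"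
    and le: "\<And>s. s \<in> ball 0 \<rho> \<Longrightarrow>
        u (z + s *s a, \<zeta> + s * b) \<le> ereal (Re (g s) - \<eta> * cmod s ^ 2 + C * cmod s ^ 4)"
    and eq: "u (z, \<zeta>) = ereal (Re (g 0))"
  shows False
  using psh_gen_no_touching[OF psh[unfolded psh2_def] p _ g pos, of "(a, b)"] dom le eq
  by (simp add: zero_prod_def)

section \<open>Rotation invariance and convexity in the logarithmic radius\<close>

definition rotation_sup :: "('a \<times> complex \<Rightarrow> ereal) \<Rightarrow> 'a \<times> complex \<Rightarrow> ereal" where
  "rotation_sup \<Phi> p = (SUP \<theta>\<in>sphere 0 1. \<Phi> (fst p, \<theta> * snd p))"

lemma rotation_sup_ge: "\<Phi> (z, \<zeta>) \<le> rotation_sup \<Phi> (z, \<zeta>)"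
  unfolding rotation_sup_def by (rule SUP_upper2[of 1]) auto

lemma rotation_in_annS: "\<theta> \<in> sphere 0 1 \<Longrightarrow> \<zeta> \<in> annS \<Longrightarrow> \<theta> * \<zeta> \<in> annS"
  by (simp add: annS_def norm_mult)

text \<open>A supremum over the whole circle absorbs a further rotation; rotating forth and back
  gives both inequalities. The case \<open>\<xi> = 0\<close> is separate because the rotation is
  found as a quotient.\<close>

lemma rotation_sup_cong:
  assumes "cmod \<zeta> = cmod \<xi>"
  shows "rotation_sup \<Phi> (z, \<zeta>) = rotation_sup \<Phi> (z, \<xi>)"
proof (cases "\<xi> = 0")
  case False
  have *: "rotation_sup \<Phi> (z, \<theta> * \<xi>) \<le> rotation_sup \<Phi> (z, \<xi>)" if "cmod \<theta> = 1" for \<theta> \<xi>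
    unfolding rotation_sup_def
  proof (rule SUP_least)
    fix \<alpha> assume "\<alpha> \<in> sphere (0::complex) 1"
    then show "\<Phi> (fst (z, \<theta> * \<xi>), \<alpha> * snd (z, \<theta> * \<xi>))
        \<le> (SUP \<theta>\<in>sphere 0 1. \<Phi> (fst (z, \<xi>), \<theta> * snd (z, \<xi>)))"
      using that by (intro SUP_upper2[of "\<alpha> * \<theta>"]) (auto simp: norm_mult mult.assoc)
  qed
  have "\<zeta> \<noteq> 0" using assms False by auto
  then show ?thesis
    using *[of "\<zeta>/\<xi>" \<xi>] *[of "\<xi>/\<zeta>" \<zeta>] assms False by (simp add: norm_divide)
qed (use assms in auto)

text \<open>The group of rotations is compact, so the supremum is attained and needs no
  regularization. For the mean value inequality, the rotation attaining the supremum at the centre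
  is fixed: that single rotated copy of \<open>\<Phi>\<close> has the given majorant on the
  circle.\<close>

lemma
  assumes psh: "psh2 \<Phi> (D \<times> annS)"
  shows rotation_sup_attained: "\<And>z \<zeta>. z \<in> D \<Longrightarrow> \<zeta> \<in> annS \<Longrightarrow>
      \<exists>\<theta>\<in>sphere 0 1. rotation_sup \<Phi> (z, \<zeta>) = \<Phi> (z, \<theta> * \<zeta>)"
    and psh2_rotation_sup: "psh2 (rotation_sup \<Phi>) (D \<times> annS)"
proof -
  define f where "f = (\<lambda>q. \<Phi> (fst (fst q), snd q * snd (fst q)))"
  have f: "usc_on ((D \<times> annS) \<times> sphere 0 1) f"
    unfolding f_def
    by (rule usc_on_compose[OF psh2_usc[OF psh]])
      (auto intro!: continuous_intros rotation_in_annS)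
  have sup: "rotation_sup \<Phi> = (\<lambda>p. SUP \<theta>\<in>sphere 0 1. f (p, \<theta>))"
    by (simp add: rotation_sup_def f_def fun_eq_iff)
  note S = usc_on_SUP_compact[OF f compact_sphere, folded sup]
  show att: "\<exists>\<theta>\<in>sphere 0 1. rotation_sup \<Phi> (z, \<zeta>) = \<Phi> (z, \<theta> * \<zeta>)"
    if "z \<in> D" "\<zeta> \<in> annS" for z \<zeta>
    using S(2)[of "(z, \<zeta>)"] that by (auto simp: f_def sup)
  show "psh2 (rotation_sup \<Phi>) (D \<times> annS)"
  proof (rule psh2I)
    show "open (D \<times> annS)" using psh by (rule psh2_open)
    show "usc_on (D \<times> annS) (rotation_sup \<Phi>)" using S(1) by simp
    show "rotation_sup \<Phi> p < \<infinity>" if "p \<in> D \<times> annS" for p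
      using att[of "fst p" "snd p"] that rotation_in_annS[of _ "snd p"]
        psh2_less_PInf[OF psh] by (metis mem_Sigma_iff prod.collapse mem_Times_iff)
  next
    fix z0 \<zeta>0 a b w0 r h
    assume p: "(z0, \<zeta>0) \<in> D \<times> annS" and r: "0 < r"
      and dom: "\<And>w. w \<in> cball w0 r \<Longrightarrow> (z0 + w *s a, \<zeta>0 + w * b) \<in> D \<times> annS"
      and h: "continuous_on (sphere w0 r) h"
      and le: "\<And>w. w \<in> sphere w0 r \<Longrightarrow>
          rotation_sup \<Phi> (z0 + w *s a, \<zeta>0 + w * b) \<le> ereal (h w)"
    have "(z0 + w0 *s a, \<zeta>0 + w0 * b) \<in> D \<times> annS" using dom r by simp
    then obtain \<theta> where \<theta>: "\<theta> \<in> sphere 0 1" and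
      eq: "rotation_sup \<Phi> (z0 + w0 *s a, \<zeta>0 + w0 * b) = \<Phi> (z0 + w0 *s a, \<theta> * (\<zeta>0 + w0 * b))"
      using att by blast
    have "\<Phi> (z0 + w0 *s a, \<theta> * \<zeta>0 + w0 * (\<theta> * b)) \<le>
        ereal (1 / (2*pi) * integral {0..2*pi} (\<lambda>t. h (w0 + complex_of_real r * cis t)))"
    proof (rule psh2_submean[OF psh _ r _ h])
      show "(z0, \<theta> * \<zeta>0) \<in> D \<times> annS" using p \<theta> rotation_in_annS by blast
      show "(z0 + w *s a, \<theta> * \<zeta>0 + w * (\<theta> * b)) \<in> D \<times> annS" if "w \<in> cball w0 r" for w
        using dom[OF that] rotation_in_annS[OF \<theta>, of "\<zeta>0 + w * b"] by (simp add: algebra_simps)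
      show "\<Phi> (z0 + w *s a, \<theta> * \<zeta>0 + w * (\<theta> * b)) \<le> ereal (h w)" if "w \<in> sphere w0 r" for w
      proof -
        have "\<Phi> (z0 + w *s a, \<theta> * (\<zeta>0 + w * b)) \<le> rotation_sup \<Phi> (z0 + w *s a, \<zeta>0 + w * b)"
          unfolding rotation_sup_def by (rule SUP_upper2[OF \<theta>]) simp
        then show ?thesis using le[OF that] by (simp add: algebra_simps)
      qed
    qed
    then show "rotation_sup \<Phi> (z0 + w0 *s a, \<zeta>0 + w0 * b) \<le>
        ereal (1 / (2*pi) * integral {0..2*pi} (\<lambda>t. h (w0 + complex_of_real r * cis t)))"
      unfolding eq by (simp add: algebra_simps)
  qed
qed

text \<open>Divided by its central value \<open>c\<close>, an affine map without zeros on the disc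
  stays in the right half plane there, where the principal logarithm is holomorphic; its real part
  is the function to be averaged.\<close>

lemma mean_ln_cmod_affine:
  assumes r: "0 < r" and nz: "\<And>w. w \<in> cball w0 r \<Longrightarrow> \<zeta> + w * b \<noteq> 0"
  shows "((\<lambda>t. ln (cmod (\<zeta> + (w0 + of_real r * cis t) * b))) has_integral
    (2*pi * ln (cmod (\<zeta> + w0 * b)))) {0..2*pi}"
proof -
  define c where "c = \<zeta> + w0 * b"
  have c: "c \<noteq> 0" using nz[of w0] r by (simp add: c_def)
  define S where "S = {w. Re ((\<zeta> + w * b) / c) > 0}"
  have "open S" unfolding S_def by (intro open_Collect_less continuous_intros) (use c in auto)
  \<comment> \<open>Otherwise the zero \<open>w0 - c / b\<close> of the affine map would lie in the
    disc.\<close>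
  have small: "r * cmod b < cmod c"
  proof (rule ccontr)
    assume n: "\<not> r * cmod b < cmod c"
    then have "b \<noteq> 0" using c by auto
    then have "\<zeta> + (w0 - c / b) * b = 0" by (simp add: c_def field_simps)
    moreover have "w0 - c / b \<in> cball w0 r"
      using n \<open>b \<noteq> 0\<close> by (simp add: dist_norm norm_divide field_simps)
    ultimately show False using nz by blast
  qed
  have sub: "cball w0 r \<subseteq> S"
  proof
    fix w assume w: "w \<in> cball w0 r"
    have eq: "(\<zeta> + w * b) / c = 1 + (w - w0) * b / c"
      using c by (simp add: c_def field_simps)
    have "cmod ((w - w0) * b / c) < 1"
    proof -
      have "cmod (w - w0) * cmod b \<le> r * cmod b"
        using w by (intro mult_right_mono) (auto simp: dist_norm norm_minus_commute)
      then have "cmod (w - w0) * cmod b < cmod c" using small by linarith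
      then show ?thesis using c by (simp add: norm_mult norm_divide)
    qed
    then have "\<bar>Re ((w - w0) * b / c)\<bar> < 1" using abs_Re_le_cmod le_less_trans by blast
    then show "w \<in> S" unfolding S_def eq mem_Collect_eq plus_complex.sel by simp
  qed
  define L where "L = (\<lambda>w. Ln ((\<zeta> + w * b) / c) + of_real (ln (cmod c)))"
  have "L holomorphic_on S"
    unfolding L_def using c
    by (intro holomorphic_intros) (auto simp: S_def complex_nonpos_Reals_iff)
  from circle_mean_Re[OF r this \<open>open S\<close> sub]
  have *: "((\<lambda>t. Re (L (w0 + of_real r * cis t))) has_integral (2*pi * Re (L w0))) {0..2*pi}" .
  have L: "Re (L w) = ln (cmod (\<zeta> + w * b))" if "w \<in> cball w0 r" for w
    using nz[OF that] c by (simp add: L_def norm_divide ln_div)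
  have "w0 + of_real r * cis t \<in> cball w0 r" for t
    using r by (simp add: dist_norm norm_mult)
  with * show ?thesis using r by (simp add: L)
qed

text \<open>Along complex lines in the annulus \<open>ln (cmod \<zeta>)\<close> is harmonic, so a
  multiple of either sign can be moved to the majorant \<open>h\<close> with an exactly known
  mean.\<close>

lemma psh2_minus_ln:
  assumes psh: "psh2 \<Phi> (D \<times> annS)"
  shows "psh2 (\<lambda>p. \<Phi> p + ereal (- \<beta> * ln (cmod (snd p)))) (D \<times> annS)"
proof (rule psh2I)
  show "open (D \<times> annS)" using psh by (rule psh2_open)
  show "usc_on (D \<times> annS) (\<lambda>p. \<Phi> p + ereal (- \<beta> * ln (cmod (snd p))))"
    using annS_nonzero
    by (intro usc_on_add_continuous psh2_usc[OF psh] continuous_intros) auto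
  show "\<Phi> p + ereal (- \<beta> * ln (cmod (snd p))) < \<infinity>" if "p \<in> D \<times> annS" for p
    using psh2_less_PInf[OF psh that] by auto
next
  fix z0 \<zeta>0 a b w0 r h
  assume p: "(z0, \<zeta>0) \<in> D \<times> annS" and r: "0 < r"
    and dom: "\<And>w. w \<in> cball w0 r \<Longrightarrow> (z0 + w *s a, \<zeta>0 + w * b) \<in> D \<times> annS"
    and h: "continuous_on (sphere w0 r) h"
    and le: "\<And>w. w \<in> sphere w0 r \<Longrightarrow> \<Phi> (z0 + w *s a, \<zeta>0 + w * b)
        + ereal (- \<beta> * ln (cmod (snd (z0 + w *s a, \<zeta>0 + w * b)))) \<le> ereal (h w)"
  define k where "k = (\<lambda>w. \<beta> * ln (cmod (\<zeta>0 + w * b)))"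
  have nz: "\<zeta>0 + w * b \<noteq> 0" if "w \<in> cball w0 r" for w
    using dom[OF that] annS_nonzero by auto
  have "\<Phi> (z0 + w0 *s a, \<zeta>0 + w0 * b) \<le>
      ereal (1 / (2*pi) * integral {0..2*pi} (\<lambda>t. (\<lambda>w. h w + k w) (w0 + of_real r * cis t)))"
  proof (rule psh2_submean[OF psh p r dom])
    show "continuous_on (sphere w0 r) (\<lambda>w. h w + k w)"
      unfolding k_def by (intro continuous_intros h) (use nz in auto)
    show "\<Phi> (z0 + w *s a, \<zeta>0 + w * b) \<le> ereal (h w + k w)" if "w \<in> sphere w0 r" for w
      using le[OF that] unfolding ereal_add_real_le_iff by (simp add: k_def)
  qed auto
  also have "integral {0..2*pi} (\<lambda>t. (\<lambda>w. h w + k w) (w0 + of_real r * cis t)) =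
      integral {0..2*pi} (\<lambda>t. h (w0 + of_real r * cis t)) + 2*pi * k w0"
  proof (rule integral_unique, rule has_integral_add)
    show "((\<lambda>t. h (w0 + of_real r * cis t)) has_integral
        integral {0..2*pi} (\<lambda>t. h (w0 + of_real r * cis t))) {0..2*pi}"
      using r by (intro integrable_integral integrable_continuous_real
          continuous_on_compose2[OF h] continuous_intros) (auto simp: dist_norm norm_mult)
    show "((\<lambda>t. k (w0 + of_real r * cis t)) has_integral (2*pi * k w0)) {0..2*pi}"
      using has_integral_mult_right[OF mean_ln_cmod_affine[OF r, of w0 \<zeta>0 b], of \<beta>] nz
      by (simp add: k_def mult_ac)
  qed
  also have "1 / (2*pi) * (integral {0..2*pi} (\<lambda>t. h (w0 + of_real r * cis t)) + 2*pi * k w0) =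
      1 / (2*pi) * integral {0..2*pi} (\<lambda>t. h (w0 + of_real r * cis t)) + k w0"
    by (simp add: field_simps)
  finally show "\<Phi> (z0 + w0 *s a, \<zeta>0 + w0 * b)
        + ereal (- \<beta> * ln (cmod (snd (z0 + w0 *s a, \<zeta>0 + w0 * b)))) \<le>
      ereal (1 / (2*pi) * integral {0..2*pi} (\<lambda>t. h (w0 + complex_of_real r * cis t)))"
    unfolding ereal_add_real_le_iff by (simp add: k_def)
qed

section \<open>A three circles theorem and its sublevel sets\<close>

definition rotation_invariant :: "'a set \<Rightarrow> ('a \<times> complex \<Rightarrow> ereal) \<Rightarrow> bool" where
  "rotation_invariant D \<Psi> \<longleftrightarrow>
    (\<forall>z\<in>D. \<forall>\<zeta>\<in>annS. \<forall>\<xi>\<in>annS. cmod \<zeta> = cmod \<xi> \<longrightarrow> \<Psi> (z, \<zeta>) = \<Psi> (z, \<xi>))"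

lemma exp_in_annS_iff: "of_real (exp t) \<in> annS \<longleftrightarrow> t \<in> {0<..<1}"
  by (auto simp: annS_def)

text \<open>Hadamard's three circles argument: subtracting
  \<open>\<beta> * ln (cmod \<zeta>)\<close> brings the bounds on both boundary circles to the same
  level \<open>m\<close>. If \<open>v\<close> exceeded \<open>m\<close> in between, then
  \<open>v\<close> plus a small multiple of \<open>cmod \<zeta> ^ 2\<close> would have an interior
  maximum, which \<open>psh2_no_touching\<close> excludes.\<close>

lemma psh2_log_convex:
  assumes psh: "psh2 \<Psi> (D \<times> annS)" and rot: "rotation_invariant D \<Psi>" and z: "z \<in> D"
    and t: "0 < t1" "t1 < t2" "t2 < 1" "t1 \<le> t" "t \<le> t2"
    and A1: "\<Psi> (z, of_real (exp t1)) \<le> ereal A1" and A2: "\<Psi> (z, of_real (exp t2)) \<le> ereal A2"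
  shows "\<Psi> (z, of_real (exp t)) \<le> ereal (A1 + (A2 - A1) / (t2 - t1) * (t - t1))"
proof (rule ccontr)
  assume n: "\<not> ?thesis"
  \<comment> \<open>Slope and, as \<open>m\<close>, intercept of the chord through
    \<open>(t1, A1)\<close> and \<open>(t2, A2)\<close>.\<close>
  define \<beta> where "\<beta> = (A2 - A1) / (t2 - t1)"
  define m where "m = A1 - \<beta> * t1"
  have m2: "m = A2 - \<beta> * t2" using t by (simp add: m_def \<beta>_def field_simps)
  define v where "v = (\<lambda>p. \<Psi> p + ereal (- \<beta> * ln (cmod (snd p))))"
  have v: "psh2 v (D \<times> annS)" unfolding v_def by (rule psh2_minus_ln[OF psh])
  define X where "X = {\<zeta>. exp t1 \<le> cmod \<zeta> \<and> cmod \<zeta> \<le> exp t2}"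
  have X: "X \<subseteq> annS"
  proof
    fix \<zeta> assume "\<zeta> \<in> X"
    moreover have "1 < exp t1" "exp t2 < exp 1" using t by simp_all
    ultimately show "\<zeta> \<in> annS" unfolding X_def annS_def mem_Collect_eq by linarith
  qed
  have "X = cball 0 (exp t2) - ball 0 (exp t1)" by (auto simp: X_def)
  then have "compact X" by (metis compact_cball compact_diff open_ball)
  have tX: "of_real (exp t) \<in> X" using t by (simp add: X_def)
  have gt: "ereal m < v (z, of_real (exp t))"
  proof -
    have "A1 + \<beta> * (t - t1) = m + \<beta> * t" by (simp add: m_def algebra_simps)
    then have "ereal (m + \<beta> * t) < \<Psi> (z, of_real (exp t))"
      using n unfolding \<beta>_def[symmetric] by (simp add: not_le)
    then show ?thesis by (cases "\<Psi> (z, of_real (exp t))") (auto simp: v_def)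
  qed
  then obtain M where M: "m < M" "ereal M < v (z, of_real (exp t))"
    by (meson ereal_dense2 ereal_less_eq less_ereal.simps(1))
  \<comment> \<open>With this size the perturbation is at most \<open>M - m\<close> on
    \<open>X\<close>, so \<open>G\<close> cannot exceed \<open>M\<close> on the two boundary
    circles.\<close>
  define \<eta> where "\<eta> = (M - m) / (exp t2)^2"
  have \<eta>: "0 < \<eta>" using M by (simp add: \<eta>_def)
  define G where "G = (\<lambda>\<zeta>. v (z, \<zeta>) + ereal (\<eta> * cmod \<zeta> ^ 2))"
  have "usc_on X (\<lambda>\<zeta>. v (z, \<zeta>))"
    by (rule usc_on_compose[OF psh2_usc[OF v]]) (use X z in \<open>auto intro!: continuous_intros\<close>)
  then have "usc_on X G" unfolding G_def
    by (intro usc_on_add_continuous continuous_intros)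
  from usc_on_attains_sup[OF this \<open>compact X\<close>] tX
  obtain \<zeta> where \<zeta>: "\<zeta> \<in> X" and max: "\<And>\<xi>. \<xi> \<in> X \<Longrightarrow> G \<xi> \<le> G \<zeta>" by blast
  have MG: "ereal M < G \<zeta>"
  proof -
    have "0 < \<eta> * cmod (of_real (exp t)) ^ 2" using \<eta> by simp
    then have "ereal M < G (of_real (exp t))"
      using M(2) unfolding G_def
      by (cases "v (z, of_real (exp t))") (simp_all del: norm_of_real norm_exp)
    then show ?thesis using max[OF tX] by simp
  qed
  have bdry: "cmod \<zeta> \<noteq> exp s" if "\<Psi> (z, of_real (exp s)) \<le> ereal (m + \<beta> * s)" "s = t1 \<or> s = t2" for s
  proof
    assume s: "cmod \<zeta> = exp s"
    then have "\<Psi> (z, \<zeta>) = \<Psi> (z, of_real (exp s))"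
      using rot z \<zeta> X t that exp_in_annS_iff unfolding rotation_invariant_def
      by (metis (no_types, lifting) abs_exp_cancel norm_of_real subset_eq greaterThanLessThan_iff less_trans)
    then have "v (z, \<zeta>) \<le> ereal m"
      using that(1) s by (simp add: v_def ereal_add_real_le_iff)
    moreover have "\<eta> * cmod \<zeta> ^ 2 \<le> \<eta> * (exp t2)^2"
      using \<eta> s that t by (intro mult_left_mono power_mono) auto
    ultimately have "G \<zeta> \<le> ereal m + ereal (\<eta> * (exp t2)^2)"
      unfolding G_def by (intro add_mono) auto
    also have "\<dots> = ereal M" by (simp add: \<eta>_def)
    finally show False using MG by simp
  qed
  have "cmod \<zeta> \<noteq> exp t1" "cmod \<zeta> \<noteq> exp t2"
    using bdry[of t1] bdry[of t2] A1 A2 by (auto simp: m_def) (auto simp: m2[unfolded m_def])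
  then have "\<zeta> \<in> {\<zeta>. exp t1 < cmod \<zeta>} \<inter> {\<zeta>. cmod \<zeta> < exp t2}" using \<zeta> by (auto simp: X_def)
  moreover have "open ({\<zeta>. exp t1 < cmod \<zeta>} \<inter> {\<zeta>. cmod \<zeta> < exp t2})"
    by (intro open_Int open_Collect_less continuous_intros)
  ultimately obtain \<rho> where \<rho>: "0 < \<rho>"
      "ball \<zeta> \<rho> \<subseteq> {\<zeta>. exp t1 < cmod \<zeta>} \<inter> {\<zeta>. cmod \<zeta> < exp t2}"
    using open_contains_ball by blast
  have inX: "\<zeta> + s \<in> X" if "s \<in> ball 0 \<rho>" for s
  proof -
    have "\<zeta> + s \<in> ball \<zeta> \<rho>" using that by (simp add: dist_norm)
    then show ?thesis using \<rho>(2) by (auto simp: X_def)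
  qed
  have "v (z, \<zeta>) < \<infinity>" using psh2_less_PInf[OF v] z \<zeta> X by blast
  then obtain k where k: "v (z, \<zeta>) = ereal k"
    using MG by (cases "v (z, \<zeta>)") (auto simp: G_def)
  \<comment> \<open>The linear term of the expansion of \<open>cmod (\<zeta> + s) ^ 2\<close> is the
    real part of a holomorphic function and goes into \<open>g\<close>; only
    \<open>- \<eta> * (cmod s)^2\<close> is left.\<close>
  define g where "g = (\<lambda>s. of_real k - of_real (2*\<eta>) * cnj \<zeta> * s)"
  show False
  proof (rule psh2_no_touching[OF v _ _ \<rho>(1) \<eta>, where C=0 and g=g and a=0 and b=1 and z=z and \<zeta>=\<zeta>])
    show "(z, \<zeta>) \<in> D \<times> annS" using z \<zeta> X by blast
    show "g holomorphic_on ball 0 \<rho>" unfolding g_def by (intro holomorphic_intros)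
    show "(z + s *s 0, \<zeta> + s * 1) \<in> D \<times> annS" if "s \<in> ball 0 \<rho>" for s
      using inX[OF that] X z by auto
    show "v (z + s *s 0, \<zeta> + s * 1) \<le> ereal (Re (g s) - \<eta> * (cmod s)^2 + 0 * cmod s ^ 4)"
      if "s \<in> ball 0 \<rho>" for s
    proof -
      have "G (\<zeta> + s) \<le> G \<zeta>" by (rule max[OF inX[OF that]])
      then have "v (z, \<zeta> + s) \<le> ereal (k + \<eta> * cmod \<zeta> ^ 2 - \<eta> * cmod (\<zeta> + s) ^ 2)"
        by (cases "v (z, \<zeta> + s)") (auto simp: G_def k)
      also have "k + \<eta> * cmod \<zeta> ^ 2 - \<eta> * cmod (\<zeta> + s) ^ 2 = Re (g s) - \<eta> * (cmod s)^2"
        unfolding cmod_power2 by (simp add: g_def power2_eq_square algebra_simps)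
      finally show ?thesis by simp
    qed
    show "v (z, \<zeta>) = ereal (Re (g 0))" by (simp add: k g_def)
  qed simp
qed

text \<open>A function below its chords has sublevel sets that are intervals, and subtracting
  \<open>c * t\<close> does not affect this. These sets are the fibres from which near-minimisers
  are selected later.\<close>

lemma convex_sublevel_radial:
  assumes psh: "psh2 \<Psi> (D \<times> annS)" and rot: "rotation_invariant D \<Psi>" and z: "z \<in> D"
  shows "convex {t\<in>{0<..<1}. \<Psi> (z, of_real (exp t)) + ereal (- c * t) < ereal B}" (is "convex ?S")
proof -
  have "t \<in> ?S" if t1: "t1 \<in> ?S" and t2: "t2 \<in> ?S" and t: "t1 \<le> t" "t \<le> t2" for t1 t2 t
  proof (cases "t1 = t2")
    case False
    \<comment> \<open>Real bounds stand in for the endpoint values, which may be minus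
      infinity.\<close>
    have ex: "\<exists>A. \<Psi> (z, of_real (exp s)) \<le> ereal A \<and> A < B + c * s" if "s \<in> ?S" for s
    proof -
      have "\<Psi> (z, of_real (exp s)) < ereal (B + c * s)"
        using that by (cases "\<Psi> (z, of_real (exp s))") auto
      then show ?thesis by (metis ereal_dense2 less_ereal.simps(1) less_imp_le)
    qed
    obtain A1 where A1: "\<Psi> (z, of_real (exp t1)) \<le> ereal A1" "A1 < B + c * t1" using ex t1 by blast
    obtain A2 where A2: "\<Psi> (z, of_real (exp t2)) \<le> ereal A2" "A2 < B + c * t2" using ex t2 by blast
    have lt: "t1 < t2" using t False by simp
    define l where "l = (t - t1) / (t2 - t1)"
    have "t = t1 + l * (t2 - t1)" using lt by (simp add: l_def)
    then have l: "0 \<le> l" "l \<le> 1" "t = (1 - l) * t1 + l * t2"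
      using t lt by (simp_all add: l_def left_diff_distrib right_diff_distrib)
    have "\<Psi> (z, of_real (exp t)) \<le> ereal (A1 + (A2 - A1) / (t2 - t1) * (t - t1))"
      using psh2_log_convex[OF psh rot z _ lt _ t A1(1) A2(1)] t1 t2 by auto
    also have "(A2 - A1) / (t2 - t1) * (t - t1) = l * (A2 - A1)" by (simp add: l_def)
    also have "A1 + l * (A2 - A1) = (1 - l) * A1 + l * A2" by (simp add: algebra_simps)
    also have "\<dots> < (1 - l) * (B + c * t1) + l * (B + c * t2)"
    proof (cases "l = 0")
      case False
      have "(1 - l) * A1 \<le> (1 - l) * (B + c * t1)" using l A1(2) by (intro mult_left_mono) auto
      moreover have "l * A2 < l * (B + c * t2)"
        using l False A2(2) by (intro mult_strict_left_mono) auto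
      ultimately show ?thesis by (rule add_le_less_mono)
    qed (use A1(2) in simp)
    also have "\<dots> = B + c * t" unfolding l(3) by (simp add: algebra_simps)
    finally have "\<Psi> (z, of_real (exp t)) < ereal (B + c * t)" by simp
    then show ?thesis using t t1 t2 by (cases "\<Psi> (z, of_real (exp t))") auto
  qed (use t1 t in auto)
  then have "is_interval ?S" unfolding is_interval_1 by blast
  then show ?thesis by (simp add: is_interval_convex_1)
qed

section \<open>Selections on circles by real parts of entire functions\<close>

text \<open>On the circle \<open>\<xi> * cnj \<xi> = 1\<close>, so the product of the two
  non-constant parts loses a factor \<open>\<xi>\<close> on each side and induction applies. The
  other terms are holomorphic or antiholomorphic, and conjugation preserves real parts.\<close>

lemma Re_mult_cnj_poly_on_circle:
  "\<exists>q::complex poly. \<forall>\<xi>\<in>sphere 0 1. Re (poly p1 \<xi> * cnj (poly p2 \<xi>)) = Re (poly q \<xi>)"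
proof (induction p1 arbitrary: p2)
  case 0
  show ?case by (rule exI[of _ 0]) simp
next
  case (pCons a p1)
  obtain b p where p2: "p2 = pCons b p" by (cases p2)
  obtain q where q: "\<forall>\<xi>\<in>sphere 0 1. Re (poly p1 \<xi> * cnj (poly p \<xi>)) = Re (poly q \<xi>)"
    using pCons.IH by blast
  have "Re (poly (pCons a p1) \<xi> * cnj (poly p2 \<xi>)) =
      Re (poly (smult (cnj a) p2 + smult (cnj b) (pCons 0 p1) + q) \<xi>)" if "\<xi> \<in> sphere 0 1" for \<xi>
  proof -
    have "\<xi> * cnj \<xi> = 1" using that by (simp add: complex_norm_square[symmetric])
    then have "poly (pCons a p1) \<xi> * cnj (poly p2 \<xi>) =
        cnj (cnj a * poly p2 \<xi>) + cnj b * (\<xi> * poly p1 \<xi>) + poly p1 \<xi> * cnj (poly p \<xi>)"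
      unfolding p2 by (simp add: algebra_simps)
    then show ?thesis using q that by (simp add: algebra_simps)
  qed
  then show ?case by blast
qed

text \<open>Closure under products comes from
  \<open>Re P * Re Q = (Re (P * Q) + Re (P * cnj Q)) / 2\<close>, the last term being a real part of
  a polynomial on the circle by the previous lemma.\<close>

lemma real_polynomial_function_eq_Re_poly_on_circle:
  fixes f :: "complex \<Rightarrow> real"
  assumes "real_polynomial_function f"
  shows "\<exists>q::complex poly. \<forall>\<xi>\<in>sphere 0 1. f \<xi> = Re (poly q \<xi>)"
  using assms
proof induction
  case (linear f)
  interpret bounded_linear f by fact
  have "f \<xi> = Re (poly [:0, Complex (f 1) (- f \<i>):] \<xi>)" for \<xi>
  proof -
    have "f \<xi> = f (Re \<xi> *\<^sub>R 1 + Im \<xi> *\<^sub>R \<i>)"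
      by (rule arg_cong[of _ _ f]) (simp add: complex_eq_iff)
    also have "\<dots> = Re \<xi> * f 1 + Im \<xi> * f \<i>" by (simp only: add scaleR real_scaleR_def)
    finally show ?thesis by (simp add: algebra_simps)
  qed
  then show ?case by blast
next
  case (const c)
  show ?case by (rule exI[of _ "[:of_real c:]"]) simp
next
  case (add f g)
  then obtain p q :: "complex poly" where "\<forall>\<xi>\<in>sphere 0 1. f \<xi> = Re (poly p \<xi>)"
    "\<forall>\<xi>\<in>sphere 0 1. g \<xi> = Re (poly q \<xi>)" by blast
  then show ?case by (intro exI[of _ "p + q"]) simp
next
  case (mult f g)
  then obtain p q :: "complex poly" where *: "\<forall>\<xi>\<in>sphere 0 1. f \<xi> = Re (poly p \<xi>)"
    "\<forall>\<xi>\<in>sphere 0 1. g \<xi> = Re (poly q \<xi>)" by blast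
  obtain k where k: "\<forall>\<xi>\<in>sphere 0 1. Re (poly p \<xi> * cnj (poly q \<xi>)) = Re (poly k \<xi>)"
    using Re_mult_cnj_poly_on_circle by blast
  have "f \<xi> * g \<xi> = Re (poly (smult (1/2) (p * q + k)) \<xi>)" if "\<xi> \<in> sphere 0 1" for \<xi>
  proof -
    have "Re (poly k \<xi>) = Re (poly p \<xi>) * Re (poly q \<xi>) + Im (poly p \<xi>) * Im (poly q \<xi>)"
      using k that by simp
    then show ?thesis using * that by (simp add: field_simps)
  qed
  then show ?case by blast
qed

text \<open>Stone-Weierstrass on the unit circle, followed by an affine change of variable.\<close>

lemma continuous_on_circle_approx_Re_entire:
  assumes T: "continuous_on (sphere w0 r) T" and r: "0 < r" and e: "0 < e"
  obtains q where "q holomorphic_on UNIV" "\<And>w. w \<in> sphere w0 r \<Longrightarrow> \<bar>T w - Re (q w)\<bar> < e"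
proof -
  have "continuous_on (sphere 0 1) (\<lambda>\<xi>. T (w0 + of_real r * \<xi>))"
    using r by (intro continuous_on_compose2[OF T] continuous_intros) (auto simp: dist_norm norm_mult)
  then obtain f where f: "real_polynomial_function f"
    "\<And>\<xi>. \<xi> \<in> sphere 0 1 \<Longrightarrow> \<bar>T (w0 + of_real r * \<xi>) - f \<xi>\<bar> < e"
    using Stone_Weierstrass_real_polynomial_function[OF compact_sphere _ e] by metis
  obtain p where p: "\<forall>\<xi>\<in>sphere 0 1. f \<xi> = Re (poly p \<xi>)"
    using real_polynomial_function_eq_Re_poly_on_circle[OF f(1)] by blast
  show thesis
  proof (rule that[of "\<lambda>w. poly p ((w - w0) / of_real r)"])
    show "(\<lambda>w. poly p ((w - w0) / of_real r)) holomorphic_on UNIV"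
      using r by (intro holomorphic_intros) auto
    fix w assume w: "w \<in> sphere w0 r"
    then have "(w - w0) / of_real r \<in> sphere 0 1"
      using r by (simp add: dist_norm norm_divide norm_minus_commute)
    with f(2)[OF this] p r show "\<bar>T w - Re (poly p ((w - w0) / of_real r))\<bar> < e" by simp
  qed
qed

text \<open>A value admissible at \<open>x\<close> stays admissible nearby because \<open>N\<close>
  is open. A partition of unity glues finitely many such constant choices, and convexity of the
  fibres keeps the weighted averages admissible.\<close>

lemma convex_valued_continuous_selection:
  fixes K :: "'a::metric_space set" and N :: "('a \<times> 'b::real_normed_vector) set"
  assumes K: "compact K" and N: "openin (top_of_set (K \<times> UNIV)) N"
    and convex: "\<And>x. x \<in> K \<Longrightarrow> convex {t. (x, t) \<in> N}"
    and ne: "\<And>x. x \<in> K \<Longrightarrow> \<exists>t. (x, t) \<in> N"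
  obtains T where "continuous_on K T" "\<And>x. x \<in> K \<Longrightarrow> (x, T x) \<in> N"
proof -
  obtain W where W: "open W" "N = (K \<times> UNIV) \<inter> W" using N by (auto simp: openin_open)
  obtain s where s: "\<And>x. x \<in> K \<Longrightarrow> (x, s x) \<in> N" using ne by metis
  define V where "V = (\<lambda>x. (\<lambda>y. (y, s x)) -` W)"
  have openV: "open (V x)" for x
    unfolding V_def using W(1) by (intro open_vimage continuous_intros)
  have "x \<in> V x" if "x \<in> K" for x using s[OF that] W by (simp add: V_def)
  then have "K \<subseteq> (\<Union>x\<in>K. V x)" by blast
  then obtain F where F: "F \<subseteq> K" "finite F" "K \<subseteq> (\<Union>x\<in>F. V x)"
    by (rule compactE_image[OF K, of K V, OF openV])
  define \<C> where "\<C> = V ` F"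
  have fin\<C>: "finite \<C>" using F by (simp add: \<C>_def)
  obtain H :: "'a set \<Rightarrow> 'a \<Rightarrow> real" where H: "\<And>U. U \<in> \<C> \<Longrightarrow> continuous_on K (H U) \<and> (\<forall>x\<in>K. 0 \<le> H U x)"
    "\<And>x U. \<lbrakk>U \<in> \<C>; x \<in> K; x \<notin> U\<rbrakk> \<Longrightarrow> H U x = 0"
    "\<And>x. x \<in> K \<Longrightarrow> supp_sum (\<lambda>W. H W x) \<C> = 1"
  proof (rule subordinate_partition_of_unity[of K \<C>], goal_cases)
    case 1
    show ?case using F by (simp add: \<C>_def)
  next
    case (2 U)
    then show ?case using openV by (auto simp: \<C>_def)
  next
    case (3 x)
    show ?case using fin\<C> by (intro exI[of _ UNIV]) auto
  next
    case (4 H)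
    then show ?case by (intro that[of H]) blast+
  qed
  have "\<forall>U\<in>\<C>. \<exists>x\<in>F. U = V x" by (auto simp: \<C>_def)
  then obtain c where c: "\<And>U. U \<in> \<C> \<Longrightarrow> c U \<in> F \<and> U = V (c U)" by metis
  show thesis
  proof (rule that[of "\<lambda>x. \<Sum>U\<in>\<C>. H U x *\<^sub>R s (c U)"])
    show "continuous_on K (\<lambda>x. \<Sum>U\<in>\<C>. H U x *\<^sub>R s (c U))"
      using H(1) by (intro continuous_intros) auto
    fix x assume x: "x \<in> K"
    \<comment> \<open>Only choices with nonzero weight are known to be admissible at
      \<open>x\<close>, so convexity is applied to these alone.\<close>
    define \<C>' where "\<C>' = {U\<in>\<C>. H U x \<noteq> 0}"
    have "(\<Sum>U\<in>\<C>'. H U x) = 1"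
      using H(3)[OF x] by (simp add: supp_sum_def support_on_def \<C>'_def)
    then have "(\<Sum>U\<in>\<C>'. H U x *\<^sub>R s (c U)) \<in> {t. (x, t) \<in> N}"
    proof (intro convex_sum convex x)
      fix U assume U: "U \<in> \<C>'"
      then have "x \<in> V (c U)" using H(2)[of U x] x c[of U] by (auto simp: \<C>'_def)
      then show "s (c U) \<in> {t. (x, t) \<in> N}" using x W by (auto simp: V_def)
      show "0 \<le> H U x" using U H(1) x by (auto simp: \<C>'_def)
    qed (use fin\<C> in \<open>auto simp: \<C>'_def\<close>)
    also have "(\<Sum>U\<in>\<C>'. H U x *\<^sub>R s (c U)) = (\<Sum>U\<in>\<C>. H U x *\<^sub>R s (c U))"
      using fin\<C> by (intro sum.mono_neutral_left) (auto simp: \<C>'_def)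
    finally show "(x, \<Sum>U\<in>\<C>. H U x *\<^sub>R s (c U)) \<in> N" by simp
  qed
qed

text \<open>The graph of a continuous selection is compact in an open set, hence has a uniform
  margin \<open>e\<close>; half of it pays for the approximation by \<open>Re q\<close>, half
  becomes \<open>\<delta>\<close>.\<close>

lemma Re_entire_selection_on_circle:
  assumes r: "0 < r" and N: "openin (top_of_set (sphere w0 r \<times> UNIV)) N"
    and convex: "\<And>w. w \<in> sphere w0 r \<Longrightarrow> convex {t::real. (w, t) \<in> N}"
    and ne: "\<And>w. w \<in> sphere w0 r \<Longrightarrow> \<exists>t. (w, t) \<in> N"
  obtains q \<delta> where "q holomorphic_on UNIV" "0 < \<delta>"
    "\<And>w t. w \<in> sphere w0 r \<Longrightarrow> \<bar>t - Re (q w)\<bar> < \<delta> \<Longrightarrow> (w, t) \<in> N"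
proof -
  obtain T where T: "continuous_on (sphere w0 r) T" "\<And>w. w \<in> sphere w0 r \<Longrightarrow> (w, T w) \<in> N"
    using convex_valued_continuous_selection[OF compact_sphere N convex ne] by blast
  obtain W where W: "open W" "N = (sphere w0 r \<times> UNIV) \<inter> W" using N by (auto simp: openin_open)
  define \<Gamma> where "\<Gamma> = (\<lambda>w. (w, T w)) ` sphere w0 r"
  have "compact \<Gamma>" unfolding \<Gamma>_def
    by (intro compact_continuous_image continuous_intros T compact_sphere)
  moreover have "\<Gamma> \<subseteq> W" using T(2) W(2) by (auto simp: \<Gamma>_def)
  ultimately obtain e where e: "e > 0" "(\<Union>x\<in>\<Gamma>. ball x e) \<subseteq> W"
    using compact_subset_open_imp_ball_epsilon_subset[OF _ W(1)] by blast
  obtain q where q: "q holomorphic_on UNIV" "\<And>w. w \<in> sphere w0 r \<Longrightarrow> \<bar>T w - Re (q w)\<bar> < e/2"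
    using continuous_on_circle_approx_Re_entire[OF T(1) r, of "e/2"] e by auto
  show thesis
  proof (rule that[OF q(1), of "e/2"])
    show "0 < e/2" using e by simp
    fix w t assume w: "w \<in> sphere w0 r" and t: "\<bar>t - Re (q w)\<bar> < e/2"
    have "\<bar>T w - t\<bar> < e" using q(2)[OF w] t by linarith
    then have "(w, t) \<in> ball (w, T w) e" by (simp add: dist_Pair_Pair dist_real_def)
    moreover have "(w, T w) \<in> \<Gamma>" using w by (simp add: \<Gamma>_def)
    ultimately have "(w, t) \<in> W" using e(2) by blast
    then show "(w, t) \<in> N" using W(2) w by auto
  qed
qed

section \<open>Kiselev's minimum principle\<close>

lemma holomorphic_second_order_bound:
  assumes "Q holomorphic_on UNIV"
  obtains C where "0 \<le> C"
    "\<And>s. cmod s \<le> 1 \<Longrightarrow> cmod (Q (w + s) - Q w - s * deriv Q w) \<le> C * cmod s ^ 2"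
proof -
  have h: "(deriv ^^ i) Q holomorphic_on UNIV" for i
    using assms by (intro holomorphic_higher_deriv) auto
  have "bounded ((deriv ^^ 2) Q ` cball w 1)"
    by (intro compact_imp_bounded compact_continuous_image compact_cball
        holomorphic_on_imp_continuous_on holomorphic_on_subset[OF h]) auto
  then obtain C where C: "\<And>x. x \<in> cball w 1 \<Longrightarrow> cmod ((deriv ^^ 2) Q x) \<le> C"
    unfolding bounded_iff by blast
  show thesis
  proof (rule that[of C])
    show "0 \<le> C" using order_trans[OF norm_ge_zero C[of w]] by simp
    fix s assume s: "cmod s \<le> 1"
    have "cmod ((deriv ^^ 0) Q (w + s) - (\<Sum>i\<le>1. (deriv ^^ i) Q w * ((w + s) - w) ^ i / fact i))
        \<le> C * cmod ((w + s) - w) ^ Suc 1 / fact 1"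
    proof (rule complex_Taylor[of "cball w 1"])
      show "((deriv ^^ i) Q has_field_derivative (deriv ^^ Suc i) Q x) (at x within cball w 1)" for i x
        using holomorphic_derivI[OF h[of i] open_UNIV, of x "cball w 1"] by simp
    qed (use s C in \<open>auto simp: dist_norm numeral_2_eq_2\<close>)
    then show "cmod (Q (w + s) - Q w - s * deriv Q w) \<le> C * cmod s ^ 2"
      by (simp add: algebra_simps power2_eq_square)
  qed
qed

text \<open>A maximum principle on the tube of radius \<open>\<delta>\<close> about the graph of
  \<open>Q\<close>, with \<open>Re (H w)\<close> as harmonic majorant over the boundary circle. If
  the claim failed, \<open>G\<close> would be positive at the centre and nonpositive on the boundary
  of the tube, so its maximum would be interior. The complex line through that point with slope
  \<open>deriv Q w\<close> then gives a contradiction.\<close>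

lemma psh2_le_on_holomorphic_disc:
  fixes z0 a :: "complex^'n"
  assumes v: "psh2 v \<Omega>" and r: "0 < r" and \<delta>: "0 < \<delta>" and e: "0 < e"
    and Q: "Q holomorphic_on UNIV" and H: "H holomorphic_on UNIV"
    and dom: "\<And>w \<zeta>. w \<in> cball w0 r \<Longrightarrow> \<zeta> \<in> cball (Q w) \<delta> \<Longrightarrow> (z0 + w *s a, \<zeta>) \<in> \<Omega>"
    and bound: "\<And>w \<zeta>. w \<in> cball w0 r \<Longrightarrow> \<zeta> \<in> cball (Q w) \<delta> \<Longrightarrow> v (z0 + w *s a, \<zeta>) \<le> ereal B"
    and bdry: "\<And>w \<zeta>. w \<in> sphere w0 r \<Longrightarrow> \<zeta> \<in> cball (Q w) \<delta> \<Longrightarrow> v (z0 + w *s a, \<zeta>) \<le> ereal (Re (H w))"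
  shows "v (z0 + w0 *s a, Q w0) \<le> ereal (Re (H w0) + e)"
proof (rule ccontr)
  assume n: "\<not> ?thesis"
  have contQ: "continuous_on S Q" and contH: "continuous_on S H" for S
    using Q H by (meson holomorphic_on_imp_continuous_on holomorphic_on_subset subset_UNIV)+
  define X where "X = {p. fst p \<in> cball w0 r \<and> snd p \<in> cball (Q (fst p)) \<delta>}"
  have "X = (\<lambda>p. (fst p, Q (fst p) + snd p)) ` (cball w0 r \<times> cball 0 \<delta>)"
  proof (intro set_eqI iffI)
    fix p assume "p \<in> X"
    then show "p \<in> (\<lambda>p. (fst p, Q (fst p) + snd p)) ` (cball w0 r \<times> cball 0 \<delta>)"
      by (intro image_eqI[of _ _ "(fst p, snd p - Q (fst p))"])
        (auto simp: X_def dist_norm norm_minus_commute)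
  qed (auto simp: X_def dist_norm)
  moreover have "compact \<dots>"
    by (intro compact_continuous_image compact_Times compact_cball continuous_intros
        continuous_on_compose2[OF contQ[of UNIV]]) auto
  ultimately have cX: "compact X" by simp
  \<comment> \<open>The term \<open>\<eta> * (cmod (w - w0) ^ 2 - r^2)\<close> vanishes over the
    boundary circle and costs exactly \<open>e\<close> at the centre.\<close>
  define \<eta> where "\<eta> = e / r^2"
  have \<eta>: "0 < \<eta>" "\<eta> * r^2 = e" using e r by (simp_all add: \<eta>_def)
  have "bounded (H ` cball w0 r)"
    by (intro compact_imp_bounded compact_continuous_image contH compact_cball)
  then obtain M where M: "\<And>w. w \<in> cball w0 r \<Longrightarrow> cmod (H w) \<le> M"
    unfolding bounded_iff by blast
  have "0 \<le> M" using order_trans[OF norm_ge_zero M[of w0]] r by simp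
  \<comment> \<open>On the wall of the tube the penalty is \<open>\<bar>B\<bar> + M\<close>, which
    outweighs \<open>v - Re H\<close> there.\<close>
  define K where "K = (\<bar>B\<bar> + M) / \<delta>^2"
  have K: "0 \<le> K" "K * \<delta>^2 = \<bar>B\<bar> + M" using \<delta> \<open>0 \<le> M\<close> by (simp_all add: K_def)
  define F where "F = (\<lambda>p. - Re (H (fst p)) + \<eta> * (cmod (fst p - w0) ^ 2 - r^2)
      - K * cmod (snd p - Q (fst p)) ^ 2)"
  define G where "G = (\<lambda>p. v (z0 + fst p *s a, snd p) + ereal (F p))"
  have "usc_on X (\<lambda>p. v (z0 + fst p *s a, snd p))"
    by (rule usc_on_compose[OF psh2_usc[OF v]])
      (auto intro!: continuous_intros dom simp: X_def)
  moreover have "continuous_on X F"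
    unfolding F_def
    by (intro continuous_intros continuous_on_compose2[OF contQ[of UNIV]]
        continuous_on_compose2[OF contH[of UNIV]]) auto
  ultimately have "usc_on X G" unfolding G_def by (rule usc_on_add_continuous)
  moreover have w0X: "(w0, Q w0) \<in> X" using r \<delta> by (simp add: X_def)
  ultimately obtain p where p: "p \<in> X" and max: "\<And>p'. p' \<in> X \<Longrightarrow> G p' \<le> G p"
    using usc_on_attains_sup[OF _ cX] by blast
  obtain w \<zeta> where [simp]: "p = (w, \<zeta>)" by (cases p)
  have w: "w \<in> cball w0 r" and \<zeta>: "\<zeta> \<in> cball (Q w) \<delta>" using p by (auto simp: X_def)
  have "0 < G (w0, Q w0)"
    using n \<eta> unfolding G_def F_def
    by (cases "v (z0 + w0 *s a, Q w0)") (auto simp: algebra_simps)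
  then have Gpos: "0 < G p" using max[OF w0X] by simp
  have "v (z0 + w *s a, \<zeta>) \<le> ereal B" by (rule bound[OF w \<zeta>])
  then obtain k where k: "v (z0 + w *s a, \<zeta>) = ereal k" "k \<le> B"
    using Gpos by (cases "v (z0 + w *s a, \<zeta>)") (auto simp: G_def)
  have kF: "0 < k + F p" using Gpos by (simp add: G_def k)
  have le_r: "cmod (w - w0) ^ 2 \<le> r^2"
    using w by (intro power_mono) (auto simp: dist_norm norm_minus_commute)
  have "cmod (w - w0) \<noteq> r"
  proof
    assume eq: "cmod (w - w0) = r"
    then have "v (z0 + w *s a, \<zeta>) \<le> ereal (Re (H w))"
      by (intro bdry \<zeta>) (simp add: dist_norm norm_minus_commute)
    moreover have "0 \<le> K * cmod (\<zeta> - Q w) ^ 2" using K by simp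
    ultimately show False using kF eq k by (simp add: F_def)
  qed
  then have w_less: "cmod (w - w0) < r" using w by (simp add: dist_norm norm_minus_commute)
  have "cmod (\<zeta> - Q w) \<noteq> \<delta>"
  proof
    assume eq: "cmod (\<zeta> - Q w) = \<delta>"
    have "- Re (H w) \<le> M" using M[OF w] abs_Re_le_cmod[of "H w"] by linarith
    moreover have "\<eta> * (cmod (w - w0) ^ 2 - r^2) \<le> 0"
      using \<eta> le_r by (intro mult_nonneg_nonpos) auto
    ultimately show False using kF k K eq by (simp add: F_def)
  qed
  then have \<zeta>_less: "cmod (\<zeta> - Q w) < \<delta>" using \<zeta> by (simp add: dist_norm norm_minus_commute)
  define b where "b = deriv Q w"
  define S where "S = {s. cmod (w + s - w0) < r} \<inter> {s. cmod (\<zeta> + s * b - Q (w + s)) < \<delta>}"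
  have "open S" unfolding S_def
    by (intro open_Int open_Collect_less continuous_intros continuous_on_compose2[OF contQ[of UNIV]]) auto
  moreover have "0 \<in> S" using w_less \<zeta>_less by (simp add: S_def)
  ultimately obtain \<rho>' where \<rho>': "0 < \<rho>'" "ball 0 \<rho>' \<subseteq> S" using open_contains_ball by blast
  define \<rho> where "\<rho> = min 1 \<rho>'"
  have \<rho>: "0 < \<rho>" "ball 0 \<rho> \<subseteq> S" "\<rho> \<le> 1" using \<rho>' by (auto simp: \<rho>_def)
  have inX: "(w + s, \<zeta> + s * b) \<in> X" if "s \<in> ball 0 \<rho>" for s
    using that \<rho>(2) by (auto simp: X_def S_def dist_norm norm_minus_commute)
  define R where "R = (\<lambda>s. Q (w + s) - Q w - s * b)"
  obtain C where C: "0 \<le> C" "\<And>s. cmod s \<le> 1 \<Longrightarrow> cmod (R s) \<le> C * cmod s ^ 2"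
    using holomorphic_second_order_bound[OF Q, of w] unfolding R_def b_def by blast
  define \<beta> where "\<beta> = \<zeta> - Q w"
  \<comment> \<open>Along the tangent line the offset from the graph is \<open>\<beta> - R s\<close>
    with \<open>R s\<close> of second order. Its cross term with \<open>\<beta>\<close> is harmonic
    and goes into \<open>g\<close>, as does the linear term from \<open>\<eta>\<close>;
    \<open>cmod (R s) ^ 2\<close> is of fourth order.\<close>
  define g where "g = (\<lambda>s. of_real k + H (w + s) - H w - of_real (2*\<eta>) * cnj (w - w0) * s
      - of_real (2*K) * cnj \<beta> * R s)"
  have shift: "z0 + w *s a + s *s a = z0 + (w + s) *s a" for s
    by (simp add: vector_sadd_rdistrib)
  show False
  proof (rule psh2_no_touching[OF v _ _ \<rho>(1) \<eta>(1), where C="K * C^2" and g=g and a=a and b=b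
        and z="z0 + w *s a" and \<zeta>=\<zeta>])
    show "(z0 + w *s a, \<zeta>) \<in> \<Omega>" by (rule dom[OF w \<zeta>])
    have "(\<lambda>s. Q (w + s)) holomorphic_on ball 0 \<rho>" "(\<lambda>s. H (w + s)) holomorphic_on ball 0 \<rho>"
      by (rule holomorphic_on_compose_gen[OF _ Q, unfolded o_def]
          holomorphic_on_compose_gen[OF _ H, unfolded o_def]; auto intro!: holomorphic_intros)+
    then show "g holomorphic_on ball 0 \<rho>"
      unfolding g_def R_def by (intro holomorphic_intros)
    show "(z0 + w *s a + s *s a, \<zeta> + s * b) \<in> \<Omega>" if "s \<in> ball 0 \<rho>" for s
      unfolding shift using inX[OF that] by (intro dom) (auto simp: X_def)
    show "v (z0 + w *s a + s *s a, \<zeta> + s * b) \<le>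
        ereal (Re (g s) - \<eta> * (cmod s)^2 + K * C^2 * cmod s ^ 4)" if s: "s \<in> ball 0 \<rho>" for s
    proof -
      have "G (w + s, \<zeta> + s * b) \<le> G p" by (rule max[OF inX[OF s]])
      then have "v (z0 + (w + s) *s a, \<zeta> + s * b) \<le> ereal (k + F p - F (w + s, \<zeta> + s * b))"
        by (cases "v (z0 + (w + s) *s a, \<zeta> + s * b)") (auto simp: G_def k)
      also have "k + F p - F (w + s, \<zeta> + s * b) \<le>
          Re (g s) - \<eta> * (cmod s)^2 + K * C^2 * cmod s ^ 4"
      proof -
        have "cmod (R s) ^ 2 \<le> (C * cmod s ^ 2) ^ 2"
          using C s \<rho>(3) by (intro power_mono) auto
        then have le: "K * cmod (R s) ^ 2 \<le> K * C^2 * cmod s ^ 4"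
          using mult_left_mono[OF _ K(1)] by (fastforce simp: power_mult_distrib mult.assoc)
        have e1: "cmod (\<zeta> + s * b - Q (w + s)) ^ 2 =
            cmod \<beta> ^ 2 - 2 * Re (cnj \<beta> * R s) + cmod (R s) ^ 2"
        proof -
          have "\<zeta> + s * b - Q (w + s) = \<beta> - R s" by (simp add: \<beta>_def R_def)
          then show ?thesis
            unfolding \<open>\<zeta> + s * b - Q (w + s) = \<beta> - R s\<close> cmod_power2
            by (simp add: power2_eq_square algebra_simps)
        qed
        have e2: "cmod (w + s - w0) ^ 2 =
            cmod (w - w0) ^ 2 + 2 * Re (cnj (w - w0) * s) + cmod s ^ 2"
          unfolding cmod_power2 by (simp add: power2_eq_square algebra_simps)
        have e3: "Re (g s) = k + Re (H (w + s)) - Re (H w) - 2*\<eta> * Re (cnj (w - w0) * s)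
            - 2*K * Re (cnj \<beta> * R s)"
          by (simp add: g_def algebra_simps)
        have "k + F p - F (w + s, \<zeta> + s * b) = Re (g s) - \<eta> * (cmod s)^2 + K * cmod (R s) ^ 2"
          unfolding F_def \<open>p = (w, \<zeta>)\<close> fst_conv snd_conv e1 e2 e3 \<beta>_def[symmetric]
          by (simp add: algebra_simps)
        with le show ?thesis by linarith
      qed
      finally show ?thesis by (simp add: shift)
    qed
    show "v (z0 + w *s a, \<zeta>) = ereal (Re (g 0))"
      by (simp add: k g_def R_def)
  qed (use K C in simp)
qed

text \<open>Up to sign, the Legendre transform at slope \<open>c\<close> in the logarithmic radius.
  For rotation invariant \<open>\<Psi>\<close> it is the infimum of
  \<open>\<Psi> - c * ln (cmod \<zeta>)\<close> over the fibre of the annulus.\<close>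

definition radial_inf :: "real \<Rightarrow> ('a \<times> complex \<Rightarrow> ereal) \<Rightarrow> 'a \<Rightarrow> ereal" where
  "radial_inf c \<Psi> z = (INF t\<in>{0<..<1}. \<Psi> (z, of_real (exp t)) + ereal (- c * t))"

lemma usc_on_INF:
  assumes "\<And>i. i \<in> I \<Longrightarrow> usc_on U (f i)"
  shows "usc_on U (\<lambda>x. INF i\<in>I. f i x)"
  unfolding usc_on_def
proof
  fix c
  have "{z\<in>U. (INF i\<in>I. f i z) < c} = (\<Union>i\<in>I. {z\<in>U. f i z < c})"
    by (auto simp: INF_less_iff)
  also have "openin (top_of_set U) \<dots>"
    using assms unfolding usc_on_def by (intro openin_Union) auto
  finally show "openin (top_of_set U) {z\<in>U. (INF i\<in>I. f i z) < c}" .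
qed

lemma psh_open: "psh u D \<Longrightarrow> open D" and psh_usc: "psh u D \<Longrightarrow> usc_on D u"
  by (simp_all add: psh_def psh_gen_def)

lemma pshI:
  fixes u :: "complex^'n \<Rightarrow> ereal"
  assumes "open D" "usc_on D u" "\<And>z. z \<in> D \<Longrightarrow> u z < \<infinity>"
    and "\<And>z0 a w0 r h. \<lbrakk>z0 \<in> D; 0 < r; \<And>w. w \<in> cball w0 r \<Longrightarrow> z0 + w *s a \<in> D;
          continuous_on (sphere w0 r) h;
          \<And>w. w \<in> sphere w0 r \<Longrightarrow> u (z0 + w *s a) \<le> ereal (h w)\<rbrakk>
        \<Longrightarrow> u (z0 + w0 *s a) \<le>
          ereal (1 / (2*pi) * integral {0..2*pi} (\<lambda>t. h (w0 + complex_of_real r * cis t)))"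
  shows "psh u D"
  unfolding psh_def
  by (rule psh_genI[OF assms(1-3)]) (use assms(4) in \<open>auto intro!: continuous_intros\<close>)

text \<open>Near-minimisers over the circle are chosen as \<open>Re q\<close>. The disc inequality
  for \<open>w \<mapsto> exp (q w)\<close> then bounds the weighted function at one point of the
  central fibre, and hence the infimum over that fibre.\<close>

theorem psh_radial_inf:
  fixes D :: "(complex^'n) set"
  assumes psh: "psh2 \<Psi> (D \<times> annS)" and D: "open D" and rot: "rotation_invariant D \<Psi>"
    and neg: "\<And>p. p \<in> D \<times> annS \<Longrightarrow> \<Psi> p \<le> 0"
  shows "psh (radial_inf c \<Psi>) D"
proof (rule pshI[OF D])
  have usc1: "usc_on D (\<lambda>z. \<Psi> (z, of_real (exp t)) + ereal (- c * t))" if "t \<in> {0<..<1}" for t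
  proof (intro usc_on_add_continuous continuous_intros usc_on_compose[OF psh2_usc[OF psh]])
    show "(\<lambda>x. (x, complex_of_real (exp t))) ` D \<subseteq> D \<times> annS"
      using exp_in_annS_iff that by auto
  qed
  then show "usc_on D (radial_inf c \<Psi>)" unfolding radial_inf_def by (rule usc_on_INF)
  show "radial_inf c \<Psi> z < \<infinity>" if "z \<in> D" for z
  proof -
    have "radial_inf c \<Psi> z \<le> \<Psi> (z, of_real (exp (1/2))) + ereal (- c * (1/2))"
      unfolding radial_inf_def by (rule INF_lower) simp
    also have "\<dots> < \<infinity>"
      using neg[of "(z, of_real (exp (1/2)))"] exp_in_annS_iff[of "1/2"] that
      by (cases "\<Psi> (z, of_real (exp (1/2)))") auto
    finally show ?thesis .
  qed
next
  fix z0 a :: "complex^'n" and w0 r h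
  assume r: "0 < r" and dom: "\<And>w. w \<in> cball w0 r \<Longrightarrow> z0 + w *s a \<in> D"
    and h: "continuous_on (sphere w0 r) h"
    and le: "\<And>w. w \<in> sphere w0 r \<Longrightarrow> radial_inf c \<Psi> (z0 + w *s a) \<le> ereal (h w)"
  define m where "m = 1 / (2*pi) * integral {0..2*pi} (\<lambda>t. h (w0 + of_real r * cis t))"
  have "radial_inf c \<Psi> (z0 + w0 *s a) \<le> ereal m + ereal (4*e)" if e: "0 < e" for e
  proof -
    \<comment> \<open>Subtracting \<open>h\<close> makes the near-minimality threshold the constant
      \<open>e\<close>, so joint upper semicontinuity of \<open>f\<close> yields openness of
      \<open>N\<close>.\<close>
    define f where "f = (\<lambda>p. \<Psi> (z0 + fst p *s a, of_real (exp (snd p))) + ereal (- c * snd p - h (fst p)))"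
    define N where "N = {p \<in> sphere w0 r \<times> {0<..<1}. f p < ereal e}"
    have N_iff: "(w, t) \<in> N \<longleftrightarrow> w \<in> sphere w0 r \<and> t \<in> {0<..<1} \<and>
        \<Psi> (z0 + w *s a, of_real (exp t)) + ereal (- c * t) < ereal (h w + e)" for w t
      unfolding N_def f_def
      by (cases "\<Psi> (z0 + w *s a, of_real (exp t))") auto
    have "usc_on (sphere w0 r \<times> {0<..<1}) f"
      unfolding f_def
    proof (intro usc_on_add_continuous usc_on_compose[OF psh2_usc[OF psh]] continuous_intros
        continuous_on_compose2[OF h])
      show "(\<lambda>p. (z0 + fst p *s a, complex_of_real (exp (snd p)))) ` (sphere w0 r \<times> {0<..<1}) \<subseteq> D \<times> annS"
        using dom exp_in_annS_iff by auto
    qed auto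
    then have "openin (top_of_set (sphere w0 r \<times> {0<..<1})) N"
      unfolding usc_on_def N_def by blast
    moreover have "openin (top_of_set (sphere w0 r \<times> (UNIV::real set))) (sphere w0 r \<times> {0<..<1})"
      by (intro openin_Times) auto
    ultimately have opN: "openin (top_of_set (sphere w0 r \<times> UNIV)) N" by (rule openin_trans)
    have "convex {t. (w, t) \<in> N}" if "w \<in> sphere w0 r" for w
      using convex_sublevel_radial[OF psh rot, of "z0 + w *s a" c "h w + e"] dom that
      by (simp add: N_iff)
    moreover have "\<exists>t. (w, t) \<in> N" if w: "w \<in> sphere w0 r" for w
    proof -
      have "radial_inf c \<Psi> (z0 + w *s a) < ereal (h w + e)"
        using le[OF w] e by (metis ereal_less_eq(3) le_less_trans less_add_same_cancel1 less_ereal.simps(1))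
      then show ?thesis using w unfolding radial_inf_def INF_less_iff N_iff by blast
    qed
    ultimately obtain q \<delta> where q: "q holomorphic_on UNIV" and \<delta>: "0 < \<delta>"
      and qN: "\<And>w t. w \<in> sphere w0 r \<Longrightarrow> \<bar>t - Re (q w)\<bar> < \<delta> \<Longrightarrow> (w, t) \<in> N"
      using Re_entire_selection_on_circle[OF r opN] by blast
    \<comment> \<open>Approximating \<open>h + 2*e\<close> within \<open>e\<close> puts
      \<open>Re H\<close> between \<open>h + e\<close>, the level defining \<open>N\<close>, and
      \<open>h + 3*e\<close>. One more \<open>e\<close> from the disc inequality gives the total
      \<open>4*e\<close>.\<close>
    have "continuous_on (sphere w0 r) (\<lambda>w. h w + 2*e)" by (intro continuous_intros h)
    then obtain H where H: "H holomorphic_on UNIV"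
      and Hh: "\<And>w. w \<in> sphere w0 r \<Longrightarrow> \<bar>h w + 2*e - Re (H w)\<bar> < e"
      using continuous_on_circle_approx_Re_entire r e by blast
    have contq: "continuous_on S q" for S
      using q by (meson holomorphic_on_imp_continuous_on holomorphic_on_subset subset_UNIV)
    have qs: "\<delta> \<le> Re (q w) \<and> Re (q w) \<le> 1 - \<delta>" if w: "w \<in> sphere w0 r" for w
    proof -
      have "0 < t \<and> t < 1" if "\<bar>t - Re (q w)\<bar> < \<delta>" for t
        using qN[OF w that] by (simp add: N_iff)
      from this[of "Re (q w) - d" for d] this[of "Re (q w) + d" for d]
      have "d < Re (q w)" "d < 1 - Re (q w)" if "0 < d" "d < \<delta>" for d
        using that by (force simp: algebra_simps)+
      then have "\<delta> \<le> Re (q w)" "\<delta> \<le> 1 - Re (q w)"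
        by - (rule dense_le_bounded[OF \<delta>]; blast intro: less_imp_le)+
      then show ?thesis by simp
    qed
    \<comment> \<open>The maximum principle for \<open>q\<close> and \<open>- q\<close> carries the
      margin from the circle to the disc, so the graph of \<open>exp q\<close> stays over the
      annulus.\<close>
    have qd: "\<delta> \<le> Re (q w) \<and> Re (q w) \<le> 1 - \<delta>" if w: "w \<in> cball w0 r" for w
    proof
      have hol: "q holomorphic_on interior (cball w0 r)"
        by (rule holomorphic_on_subset[OF q]) simp
      show "Re (q w) \<le> 1 - \<delta>"
        by (rule maximum_real_frontier[OF hol contq _ _ w]) (use qs r in auto)
      have "Re (- q w) \<le> - \<delta>"
      proof (rule maximum_real_frontier[of "\<lambda>w. - q w" "cball w0 r"])
        show "(\<lambda>w. - q w) holomorphic_on interior (cball w0 r)" by (intro holomorphic_intros hol)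
        show "continuous_on (closure (cball w0 r)) (\<lambda>w. - q w)" by (intro continuous_intros contq)
      qed (use qs w r in auto)
      then show "\<delta> \<le> Re (q w)" by simp
    qed
    define Q where "Q = (\<lambda>w. exp (q w))"
    \<comment> \<open>Since \<open>cmod (Q w) \<ge> 1 + \<delta>\<close>, a tube of radius
      \<open>\<delta>/2\<close> stays outside the unit disc, where \<open>ln\<close> is
      1-Lipschitz.\<close>
    have ln_close: "1 < cmod \<zeta> \<and> \<bar>ln (cmod \<zeta>) - Re (q w)\<bar> < \<delta>"
      if w: "w \<in> cball w0 r" and \<zeta>: "\<zeta> \<in> cball (Q w) (\<delta>/2)" for w \<zeta>
    proof -
      define y where "y = exp (Re (q w))"
      have y: "1 + \<delta> \<le> y"
        using exp_ge_add_one_self[of "Re (q w)"] qd[OF w, THEN conjunct1] unfolding y_def by linarith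
      have "\<bar>cmod \<zeta> - y\<bar> \<le> \<delta>/2"
        using \<zeta> norm_triangle_ineq3[of \<zeta> "Q w"]
        by (simp add: y_def Q_def dist_norm norm_minus_commute)
      then have x: "1 < cmod \<zeta>" "\<bar>cmod \<zeta> - y\<bar> \<le> \<delta>/2" using y \<delta> by linarith+
      have "ln (cmod \<zeta>) - ln y \<le> (cmod \<zeta> - y) / y"
        using x y \<delta> by (intro ln_diff_le) auto
      also have "\<dots> \<le> \<bar>cmod \<zeta> - y\<bar> / y" using y \<delta> by (intro divide_right_mono) auto
      also have "\<dots> \<le> \<bar>cmod \<zeta> - y\<bar> / 1" using y \<delta> by (intro divide_left_mono) auto
      finally have 1: "ln (cmod \<zeta>) - ln y \<le> \<delta>/2" using x by simp
      have "ln y - ln (cmod \<zeta>) \<le> (y - cmod \<zeta>) / cmod \<zeta>"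
        using x y \<delta> by (intro ln_diff_le) auto
      also have "\<dots> \<le> \<bar>cmod \<zeta> - y\<bar> / cmod \<zeta>" using x by (intro divide_right_mono) auto
      also have "\<dots> \<le> \<bar>cmod \<zeta> - y\<bar> / 1" using x by (intro divide_left_mono) auto
      finally have "ln y - ln (cmod \<zeta>) \<le> \<delta>/2" using x by simp
      with 1 x \<delta> show ?thesis by (simp add: y_def)
    qed
    have in_ann: "\<zeta> \<in> annS" if w: "w \<in> cball w0 r" and \<zeta>: "\<zeta> \<in> cball (Q w) (\<delta>/2)" for w \<zeta>
    proof -
      have "ln (cmod \<zeta>) < 1" using ln_close[OF w \<zeta>] qd[OF w] by linarith
      then have "cmod \<zeta> < exp 1" using ln_close[OF w \<zeta>] by (metis exp_less_mono exp_ln less_trans zero_less_one)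
      then show ?thesis using ln_close[OF w \<zeta>] by (simp add: annS_def)
    qed
    define v where "v = (\<lambda>p. \<Psi> p + ereal (- c * ln (cmod (snd p))))"
    have v_radial: "v (z, \<zeta>) = \<Psi> (z, of_real (exp (ln (cmod \<zeta>)))) + ereal (- c * ln (cmod \<zeta>))"
      if "z \<in> D" "\<zeta> \<in> annS" for z \<zeta>
    proof -
      have "0 < cmod \<zeta>" using annS_nonzero[OF that(2)] by simp
      then have "of_real (cmod \<zeta>) \<in> annS" using that(2) by (simp add: annS_def)
      moreover have "cmod \<zeta> = cmod (of_real (cmod \<zeta>))" by simp
      ultimately have "\<Psi> (z, \<zeta>) = \<Psi> (z, of_real (cmod \<zeta>))"
        using rot that unfolding rotation_invariant_def by blast
      then show ?thesis using \<open>0 < cmod \<zeta>\<close> by (simp add: v_def)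
    qed
    have ln_ann: "ln (cmod \<zeta>) \<in> {0<..<1}" if "\<zeta> \<in> annS" for \<zeta>
    proof -
      have "1 < cmod \<zeta>" "cmod \<zeta> < exp 1" using that by (auto simp: annS_def)
      then show ?thesis using ln_less_cancel_iff[of "cmod \<zeta>" "exp 1"] ln_gt_zero[of "cmod \<zeta>"]
          annS_nonzero[OF that] by auto
    qed
    have v_le: "v (z0 + w0 *s a, Q w0) \<le> ereal (Re (H w0) + e)"
    proof (rule psh2_le_on_holomorphic_disc[where v=v and Q=Q and H=H and r=r
          and \<delta>="\<delta>/2" and B="\<bar>c\<bar>" and \<Omega>="D \<times> annS"])
      show "psh2 v (D \<times> annS)" unfolding v_def by (rule psh2_minus_ln[OF psh])
      show "Q holomorphic_on UNIV" unfolding Q_def by (intro holomorphic_intros q)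
      show "(z0 + w *s a, \<zeta>) \<in> D \<times> annS" if "w \<in> cball w0 r" "\<zeta> \<in> cball (Q w) (\<delta>/2)" for w \<zeta>
        using dom in_ann that by simp
      show "v (z0 + w *s a, \<zeta>) \<le> ereal \<bar>c\<bar>" if "w \<in> cball w0 r" "\<zeta> \<in> cball (Q w) (\<delta>/2)" for w \<zeta>
      proof -
        have "- c * ln (cmod \<zeta>) \<le> \<bar>c\<bar> * 1"
          using ln_ann[OF in_ann[OF that]] by (intro mult_mono) auto
        then have "v (z0 + w *s a, \<zeta>) \<le> 0 + ereal \<bar>c\<bar>"
          unfolding v_def by (intro add_mono neg) (use dom in_ann that in auto)
        then show ?thesis by simp
      qed
      show "v (z0 + w *s a, \<zeta>) \<le> ereal (Re (H w))"
        if w: "w \<in> sphere w0 r" and \<zeta>: "\<zeta> \<in> cball (Q w) (\<delta>/2)" for w \<zeta>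
      proof -
        have w': "w \<in> cball w0 r" using w by simp
        have "(w, ln (cmod \<zeta>)) \<in> N" using ln_close[OF w' \<zeta>] by (intro qN[OF w]) simp
        then have "v (z0 + w *s a, \<zeta>) < ereal (h w + e)"
          using v_radial[OF dom[OF w'] in_ann[OF w' \<zeta>]] by (simp add: N_iff)
        also have "\<dots> \<le> ereal (Re (H w))" using Hh[OF w] by simp
        finally show ?thesis by simp
      qed
    qed (use r \<delta> e H in auto)
    have "radial_inf c \<Psi> (z0 + w0 *s a) \<le> v (z0 + w0 *s a, Q w0)"
    proof -
      have "w0 \<in> cball w0 r" "Q w0 \<in> cball (Q w0) (\<delta>/2)" using r \<delta> by auto
      then have "Q w0 \<in> annS" "z0 + w0 *s a \<in> D" using in_ann dom by blast+
      then show ?thesis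
        unfolding radial_inf_def v_radial[OF \<open>z0 + w0 *s a \<in> D\<close> \<open>Q w0 \<in> annS\<close>]
        by (intro INF_lower ln_ann)
    qed
    also note v_le
    also have "ereal (Re (H w0) + e) \<le> ereal m + ereal (4*e)"
    proof -
      have on: "w0 + of_real r * cis t \<in> sphere w0 r" for t
        using r by (simp add: dist_norm norm_mult)
      have ih: "((\<lambda>t. h (w0 + of_real r * cis t)) has_integral (2*pi*m)) {0..2*pi}"
      proof -
        have "continuous_on {0..2*pi} (\<lambda>t. h (w0 + of_real r * cis t))"
          using on by (intro continuous_on_compose2[OF h] continuous_intros) blast
        from integrable_integral[OF integrable_continuous_real[OF this]]
        show ?thesis by (simp add: m_def)
      qed
      have "2*pi * Re (H w0) \<le> 2*pi*m + 3*e*(2*pi)"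
      proof (rule has_integral_le)
        show "((\<lambda>t. Re (H (w0 + of_real r * cis t))) has_integral (2*pi * Re (H w0))) {0..2*pi}"
          by (rule circle_mean_Re[OF r H]) auto
        show "((\<lambda>t. h (w0 + of_real r * cis t) + 3*e) has_integral (2*pi*m + 3*e*(2*pi))) {0..2*pi}"
          using has_integral_add[OF ih has_integral_const_real[of "3*e" 0 "2*pi"]]
          by (simp add: mult_ac)
        show "Re (H (w0 + of_real r * cis t)) \<le> h (w0 + of_real r * cis t) + 3*e" for t
          using Hh[OF on, of t] by linarith
      qed
      then have "2*pi * Re (H w0) \<le> 2*pi * (m + 3*e)" by (simp add: algebra_simps)
      then show ?thesis by simp
    qed
    finally show ?thesis .
  qed
  note approx = this
  have "radial_inf c \<Psi> (z0 + w0 *s a) \<le> ereal m + ereal e" if "0 < e" for e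
    using approx[of "e/4"] that by simp
  then have "radial_inf c \<Psi> (z0 + w0 *s a) \<le> ereal m" by (blast intro: ereal_le_epsilon2)
  then show "radial_inf c \<Psi> (z0 + w0 *s a) \<le>
      ereal (1 / (2*pi) * integral {0..2*pi} (\<lambda>t. h (w0 + complex_of_real r * cis t)))"
    by (simp only: m_def)
qed

section \<open>Envelopes\<close>

lemma psh_add_const:
  fixes D :: "(complex^'n) set"
  assumes "psh u D"
  shows "psh (\<lambda>z. u z + ereal k) D"
proof (rule pshI)
  show "usc_on D (\<lambda>z. u z + ereal k)"
    by (intro usc_on_add_continuous psh_usc[OF assms] continuous_intros)
  show "u z + ereal k < \<infinity>" if "z \<in> D" for z
    using assms that unfolding psh_def psh_gen_def by auto
next
  fix z0 a :: "complex^'n" and w0 r h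
  assume z0: "z0 \<in> D" and r: "0 < r" and dom: "\<And>w. w \<in> cball w0 r \<Longrightarrow> z0 + w *s a \<in> D"
    and h: "continuous_on (sphere w0 r) h"
    and le: "\<And>w. w \<in> sphere w0 r \<Longrightarrow> u (z0 + w *s a) + ereal k \<le> ereal (h w)"
  have "u (z0 + w0 *s a) \<le> ereal (1 / (2*pi) *
      integral {0..2*pi} (\<lambda>t. h (w0 + complex_of_real r * cis t) - k))"
    using le by (intro psh_gen_submean[OF assms[unfolded psh_def] z0 r dom] continuous_intros h)
      (auto simp: ereal_add_real_le_iff)
  also have "integral {0..2*pi} (\<lambda>t. h (w0 + complex_of_real r * cis t) - k) =
      integral {0..2*pi} (\<lambda>t. h (w0 + complex_of_real r * cis t)) - 2*pi*k"
    using r by (subst integral_diff)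
      (auto intro!: integrable_continuous_real continuous_on_compose2[OF h] continuous_intros
        simp: dist_norm norm_mult)
  also have "1 / (2*pi) * (integral {0..2*pi} (\<lambda>t. h (w0 + complex_of_real r * cis t)) - 2*pi*k) =
      1 / (2*pi) * integral {0..2*pi} (\<lambda>t. h (w0 + complex_of_real r * cis t)) - k"
    by (simp add: field_simps)
  finally show "u (z0 + w0 *s a) + ereal k \<le> ereal (1 / (2*pi) *
      integral {0..2*pi} (\<lambda>t. h (w0 + complex_of_real r * cis t)))"
    by (simp add: ereal_add_real_le_iff)
qed (rule psh_open[OF assms])

lemma le_Limsup_nhds: "f z \<le> Limsup (nhds z) f"
  unfolding Limsup_def
  by (intro INF_greatest SUP_upper) (auto dest: eventually_nhds_x_imp_x)

text \<open>An upper semicontinuous majorant survives regularization; this is what keeps a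
  regularized envelope below its obstacle.\<close>

lemma Limsup_nhds_le_usc:
  assumes "open D" "usc_on D u" "z \<in> D" "\<And>x. x \<in> D \<Longrightarrow> f x \<le> u x"
  shows "Limsup (nhds z) f \<le> u z"
  unfolding Limsup_le_iff
proof (intro allI impI)
  fix y assume "u z < y"
  then have "eventually (\<lambda>x. x \<in> {x\<in>D. u x < y}) (nhds z)"
    using assms by (intro eventually_nhds_in_open usc_on_openD) auto
  then show "eventually (\<lambda>x. f x < y) (nhds z)"
    by eventually_elim (use assms(4) le_less_trans in blast)
qed

lemma usc_on_Limsup_nhds: "usc_on D (\<lambda>z. Limsup (nhds z) f)"
  for f :: "'a::topological_space \<Rightarrow> ereal"
  unfolding usc_on_iff
proof (intro ballI allI impI)
  fix x c assume "Limsup (nhds x) f < c"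
  then obtain d where d: "Limsup (nhds x) f < d" "d < c" using dense by blast
  then have "eventually (\<lambda>y. f y < d) (nhds x)" by (intro Limsup_lessD)
  then have "eventually (\<lambda>y. eventually (\<lambda>y. f y < d) (nhds y)) (nhds x)"
    by (simp add: eventually_eventually)
  then have "eventually (\<lambda>y. Limsup (nhds y) f < c) (nhds x)"
  proof eventually_elim
    case (elim y)
    then have "Limsup (nhds y) f \<le> d" by (intro Limsup_bounded) (auto elim: eventually_mono)
    then show ?case using d(2) by simp
  qed
  then show "\<exists>V. open V \<and> x \<in> V \<and> (\<forall>y\<in>D\<inter>V. Limsup (nhds y) f < c)"
    unfolding eventually_nhds by blast
qed

text \<open>The sub-mean-value inequality is applied to each member of \<open>F\<close> at every
  point near the centre, on a circle where \<open>V\<close> dominates that member. Upper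
  semicontinuity of \<open>V\<close> and compactness of the circle give one majorant for all nearby
  translates; supremum and limsup are taken last.\<close>

lemma psh_regularized_Sup:
  fixes D :: "(complex^'n) set"
  assumes D: "open D" and F: "\<And>w. w \<in> F \<Longrightarrow> psh w D"
    and fin: "\<And>z. z \<in> D \<Longrightarrow> Limsup (nhds z) (\<lambda>x. SUP w\<in>F. w x) < \<infinity>"
  shows "psh (\<lambda>z. Limsup (nhds z) (\<lambda>x. SUP w\<in>F. w x)) D"
proof (rule pshI[OF D usc_on_Limsup_nhds fin])
  define V where "V = (\<lambda>z. Limsup (nhds z) (\<lambda>x. SUP w\<in>F. w x))"
  have V: "w x \<le> V x" if "w \<in> F" for w x
    using that order_trans[OF SUP_upper le_Limsup_nhds[of "\<lambda>x. SUP w\<in>F. w x" x]]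
    unfolding V_def by blast
  have uscV: "usc_on D V" unfolding V_def by (rule usc_on_Limsup_nhds)
  fix z0 a :: "complex^'n" and w0 r h
  assume z0: "z0 \<in> D" and r: "0 < r" and dom: "\<And>w. w \<in> cball w0 r \<Longrightarrow> z0 + w *s a \<in> D"
    and h: "continuous_on (sphere w0 r) h"
    and le: "\<And>w. w \<in> sphere w0 r \<Longrightarrow>
      Limsup (nhds (z0 + w *s a)) (\<lambda>x. SUP w\<in>F. w x) \<le> ereal (h w)"
  define m where "m = 1 / (2*pi) * integral {0..2*pi} (\<lambda>t. h (w0 + of_real r * cis t))"
  have "V (z0 + w0 *s a) \<le> ereal m + ereal e" if e: "0 < e" for e
  proof -
    \<comment> \<open>The circle mean at a nearby centre is taken over a translated circle, on which
      the majorant \<open>h + e\<close> transported from the original circle still dominates.\<close>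
    define K where "K = cball w0 r"
    have "\<exists>X0. open X0 \<and> 0 \<in> X0 \<and> X0 \<times> K \<subseteq> {p. z0 + fst p + snd p *s a \<in> D}"
    proof -
      have "open ((\<lambda>p. z0 + fst p + snd p *s a) -` D)"
        by (intro open_vimage D continuous_intros)
      moreover have "{0} \<times> K \<subseteq> (\<lambda>p. z0 + fst p + snd p *s a) -` D"
        using dom by (auto simp: K_def)
      ultimately have "\<exists>X0. 0 \<in> X0 \<and> open X0 \<and> X0 \<times> K \<subseteq> (\<lambda>p. z0 + fst p + snd p *s a) -` D"
        unfolding K_def by (intro Elementary_Topology.tube_lemma compact_cball)
      then show ?thesis by auto
    qed
    then obtain X0 where X0: "open X0" "0 \<in> X0"
      and X0_sub: "X0 \<times> K \<subseteq> {p. z0 + fst p + snd p *s a \<in> D}" by blast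
    have X0D: "z0 + x + w *s a \<in> D" if "x \<in> X0" "w \<in> K" for x w
      using X0_sub that by auto
    define f where "f = (\<lambda>p. V (z0 + fst p + snd p *s a) + ereal (- h (snd p)))"
    have "usc_on (X0 \<times> sphere w0 r) f"
      unfolding f_def
      by (intro usc_on_add_continuous usc_on_compose[OF uscV] continuous_intros
          continuous_on_compose2[OF h]) (auto intro!: X0D simp: K_def)
    from usc_on_SUP_compact_usc[OF this compact_sphere]
    have usc: "usc_on X0 (\<lambda>x. SUP k\<in>sphere w0 r. f (x, k))" using r by simp
    have "(SUP k\<in>sphere w0 r. f (0, k)) \<le> 0"
      using le by (intro SUP_least) (auto simp: f_def V_def ereal_add_real_le_iff)
    then have "(SUP k\<in>sphere w0 r. f (0, k)) < ereal e" using e by (simp add: le_less_trans)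
    then have ev: "eventually (\<lambda>x. x \<in> {x\<in>X0. (SUP k\<in>sphere w0 r. f (x, k)) < ereal e}) (nhds 0)"
      using X0 by (intro eventually_nhds_in_open usc_on_openD usc) auto
    have "filterlim (\<lambda>x. x - (z0 + w0 *s a)) (nhds 0) (nhds (z0 + w0 *s a))"
      using tendsto_diff[OF filterlim_ident tendsto_const, of "z0 + w0 *s a" "z0 + w0 *s a"] by simp
    from eventually_compose_filterlim[OF ev this]
    have "eventually (\<lambda>x. (SUP w\<in>F. w x) \<le> ereal (m + e)) (nhds (z0 + w0 *s a))"
    proof eventually_elim
      case (elim x)
      define d where "d = x - (z0 + w0 *s a)"
      have d: "d \<in> X0" "(SUP k\<in>sphere w0 r. f (d, k)) < ereal e" using elim by (auto simp: d_def)
      have x: "x = (z0 + d) + w0 *s a" by (simp add: d_def)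
      have "w x \<le> ereal (m + e)" if w: "w \<in> F" for w
      proof -
        have "x \<in> D" unfolding x using X0D[OF d(1), of w0] r by (simp add: K_def)
        have "w (x + 0 *s a) \<le> ereal (1 / (2*pi) *
            integral {0..2*pi} (\<lambda>t. (\<lambda>k. h (w0 + k) + e) (0 + of_real r * cis t)))"
        proof (rule psh_gen_submean[OF F[OF w, unfolded psh_def] \<open>x \<in> D\<close> r])
          have shift: "x + k *s a = z0 + d + (w0 + k) *s a" for k
            unfolding x by (simp add: vector_sadd_rdistrib)
          show "x + k *s a \<in> D" if "k \<in> cball 0 r" for k
            unfolding shift using that by (intro X0D d(1)) (simp add: K_def dist_norm)
          show "continuous_on (sphere 0 r) (\<lambda>k. h (w0 + k) + e)"
            by (intro continuous_intros continuous_on_compose2[OF h]) (auto simp: dist_norm)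
          show "w (x + k *s a) \<le> ereal (h (w0 + k) + e)" if "k \<in> sphere 0 r" for k
          proof -
            have "f (d, w0 + k) < ereal e"
              using d(2) that by (intro le_less_trans[OF SUP_upper d(2)]) (auto simp: dist_norm)
            then have "V (z0 + d + (w0 + k) *s a) \<le> ereal (h (w0 + k) + e)"
              by (cases "V (z0 + d + (w0 + k) *s a)") (auto simp: f_def)
            then show ?thesis unfolding shift using V[OF w] order_trans by blast
          qed
        qed
        also have "integral {0..2*pi} (\<lambda>t. (\<lambda>k. h (w0 + k) + e) (0 + of_real r * cis t)) =
            integral {0..2*pi} (\<lambda>t. h (w0 + of_real r * cis t)) + 2*pi*e"
          using r by (simp, subst integral_add)
            (auto intro!: integrable_continuous_real continuous_on_compose2[OF h] continuous_intros
              simp: dist_norm norm_mult)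
        also have "1 / (2*pi) * (integral {0..2*pi} (\<lambda>t. h (w0 + of_real r * cis t)) + 2*pi*e) = m + e"
          by (simp add: m_def field_simps)
        finally show ?thesis by simp
      qed
      then show ?case by (rule SUP_least)
    qed
    then show ?thesis unfolding V_def by (intro Limsup_bounded) simp
  qed
  then have "V (z0 + w0 *s a) \<le> ereal m" by (blast intro: ereal_le_epsilon2)
  then show "Limsup (nhds (z0 + w0 *s a)) (\<lambda>x. SUP w\<in>F. w x) \<le>
      ereal (1 / (2*pi) * integral {0..2*pi} (\<lambda>t. h (w0 + complex_of_real r * cis t)))"
    by (simp only: V_def m_def)
qed

lemma le_g_env:
  assumes "v \<in> PSHneg D" "\<And>y. y \<in> D \<Longrightarrow> v y \<le> u y + ereal c"
  shows "v z \<le> g_env D u z"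
proof -
  have "v z \<le> Sup {v z | v. v \<in> PSHneg D \<and> (\<exists>c::real. \<forall>y\<in>D. v y \<le> u y + ereal c)}"
    using assms by (intro Sup_upper) blast
  then show ?thesis unfolding g_env_def by (rule order_trans) (rule le_Limsup_nhds)
qed

lemma le_P_env:
  assumes "psh w D" "\<And>y. y \<in> D \<Longrightarrow> w y \<le> u y" "\<And>y. y \<in> D \<Longrightarrow> w y \<le> v y"
  shows "w z \<le> P_env D u v z"
proof -
  have "w z \<le> Sup {w z | w. psh w D \<and> (\<forall>y\<in>D. w y \<le> min (u y) (v y))}"
    using assms by (intro Sup_upper) auto
  then show ?thesis unfolding P_env_def by (rule order_trans) (rule le_Limsup_nhds)
qed

section \<open>Partial Legendre transform and boundary values\<close>

text \<open>Compactness of the circle makes the pointwise limsup bounds uniform in the angle, as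
  needed to control a supremum over rotations.\<close>

lemma boundary_circle_eventually_less:
  fixes \<Phi> :: "'a::metric_space \<times> complex \<Rightarrow> ereal"
  assumes \<rho>: "0 < \<rho>" and z: "z \<in> D"
    and lim: "\<And>\<zeta>. \<zeta> \<in> sphere 0 \<rho> \<Longrightarrow> Limsup (at (z, \<zeta>) within D \<times> annS) \<Phi> < M"
    and out: "sphere 0 \<rho> \<inter> annS = {}"
  shows "\<exists>\<epsilon>>0. \<forall>\<xi>\<in>annS. \<bar>cmod \<xi> - \<rho>\<bar> < \<epsilon> \<longrightarrow> \<Phi> (z, \<xi>) < M"
proof -
  define W where "W = \<Union>{W. open W \<and> (\<forall>\<xi>\<in>W \<inter> annS. \<Phi> (z, \<xi>) < M)}"
  have "sphere 0 \<rho> \<subseteq> W"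
  proof
    fix \<zeta> assume \<zeta>: "\<zeta> \<in> sphere (0::complex) \<rho>"
    have "eventually (\<lambda>p. \<Phi> p < M) (at (z, \<zeta>) within D \<times> annS)"
      by (rule Limsup_lessD[OF lim[OF \<zeta>]])
    then obtain S where S: "open S" "(z, \<zeta>) \<in> S"
      "\<And>p. p \<in> S \<Longrightarrow> p \<noteq> (z, \<zeta>) \<Longrightarrow> p \<in> D \<times> annS \<Longrightarrow> \<Phi> p < M"
      unfolding eventually_at_topological by blast
    have "open (Pair z -` S)" by (intro open_vimage S continuous_intros)
    moreover have "\<Phi> (z, \<xi>) < M" if \<xi>: "\<xi> \<in> Pair z -` S \<inter> annS" for \<xi>
    proof -
      \<comment> \<open>The filter \<open>at\<close> omits its base point, which is harmless because
        the circle is disjoint from the annulus.\<close>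
      have "\<xi> \<noteq> \<zeta>" using \<xi> out \<zeta> by blast
      then show ?thesis using S(3)[of "(z, \<xi>)"] \<xi> z by auto
    qed
    ultimately show "\<zeta> \<in> W" using S(2) unfolding W_def by blast
  qed
  moreover have "open W" unfolding W_def by blast
  ultimately obtain \<epsilon> where \<epsilon>: "0 < \<epsilon>" "(\<Union>x\<in>sphere 0 \<rho>. ball x \<epsilon>) \<subseteq> W"
    using compact_subset_open_imp_ball_epsilon_subset[OF compact_sphere] by blast
  have "\<Phi> (z, \<xi>) < M" if \<xi>: "\<xi> \<in> annS" "\<bar>cmod \<xi> - \<rho>\<bar> < \<epsilon>" for \<xi>
  proof -
    \<comment> \<open>The radial projection of \<open>\<xi>\<close> to the circle, at distance
      \<open>\<bar>cmod \<xi> - \<rho>\<bar>\<close>.\<close>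
    define \<zeta> where "\<zeta> = of_real (\<rho> / cmod \<xi>) * \<xi>"
    have nz: "cmod \<xi> \<noteq> 0" using annS_nonzero[OF \<xi>(1)] by simp
    have "\<zeta> \<in> sphere 0 \<rho>" using nz \<rho> by (simp add: \<zeta>_def norm_mult norm_divide)
    moreover have "\<xi> \<in> ball \<zeta> \<epsilon>"
    proof -
      have "\<zeta> - \<xi> = of_real (\<rho> / cmod \<xi> - 1) * \<xi>" by (simp add: \<zeta>_def algebra_simps)
      then have "cmod (\<zeta> - \<xi>) = \<bar>\<rho> / cmod \<xi> - 1\<bar> * cmod \<xi>"
        by (simp only: norm_mult norm_of_real)
      also have "\<dots> = \<bar>(\<rho> / cmod \<xi> - 1) * cmod \<xi>\<bar>" by (simp add: abs_mult)
      also have "(\<rho> / cmod \<xi> - 1) * cmod \<xi> = \<rho> - cmod \<xi>" using nz by (simp add: field_simps)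
      finally show ?thesis using \<xi>(2) by (simp add: dist_norm)
    qed
    ultimately have "\<xi> \<in> W" using \<epsilon>(2) by blast
    then show ?thesis using \<xi>(1) unfolding W_def by blast
  qed
  then show ?thesis using \<epsilon>(1) by blast
qed

text \<open>The infimum is tested at radii \<open>exp t\<close> with \<open>t\<close> tending to the
  endpoint \<open>s\<close>. The bound near the boundary circle is uniform in the angle and so
  passes to the supremum over rotations, while \<open>c * t\<close> tends to
  \<open>c * s\<close>.\<close>

lemma radial_inf_le_boundary:
  fixes \<Phi> :: "(complex^'n) \<times> complex \<Rightarrow> ereal"
  assumes psh: "psh2 \<Phi> (D \<times> annS)" and z: "z \<in> D" and s: "s = 0 \<or> s = (1::real)"
    and lim: "\<And>\<zeta>. \<zeta> \<in> sphere 0 (exp s) \<Longrightarrow> Limsup (at (z, \<zeta>) within D \<times> annS) \<Phi> \<le> u z"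
  shows "radial_inf c (rotation_sup \<Phi>) z \<le> u z + ereal (- c * s)"
proof (rule dense_ge)
  fix M' assume M': "u z + ereal (- c * s) < M'"
  then have "u z < M' - ereal (- c * s)" by (simp add: ereal_add_real_less_iff)
  then obtain M where M: "u z < ereal M" "ereal M < M' - ereal (- c * s)"
    using ereal_dense2 by blast
  obtain N where N: "ereal (M - c * s) < ereal N" "ereal N < M'"
  proof -
    have "ereal (M - c * s) < M'" using M(2) by (cases M') auto
    then show ?thesis using ereal_dense2 that by blast
  qed
  have "\<exists>\<epsilon>>0. \<forall>\<xi>\<in>annS. \<bar>cmod \<xi> - exp s\<bar> < \<epsilon> \<longrightarrow> \<Phi> (z, \<xi>) < ereal M"
    using s by (intro boundary_circle_eventually_less[OF _ z] le_less_trans[OF lim M(1)])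
      (auto simp: annS_def)
  then obtain \<epsilon> where \<epsilon>: "0 < \<epsilon>" "\<And>\<xi>. \<xi> \<in> annS \<Longrightarrow> \<bar>cmod \<xi> - exp s\<bar> < \<epsilon> \<Longrightarrow> \<Phi> (z, \<xi>) < ereal M"
    by blast
  have nt: "at s within {0<..<1} \<noteq> bot"
    using s by (auto simp: trivial_limit_within islimpt_greaterThanLessThan1 islimpt_greaterThanLessThan2)
  have "((\<lambda>t. exp t) \<longlongrightarrow> exp s) (at s within {0<..<1})"
    by (intro tendsto_intros)
  then have "eventually (\<lambda>t. dist (exp t) (exp s) < \<epsilon>) (at s within {0<..<1})"
    using \<epsilon>(1) by (rule tendstoD)
  moreover have "((\<lambda>t. M - c * t) \<longlongrightarrow> M - c * s) (at s within {0<..<1})"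
    by (intro tendsto_intros)
  then have "eventually (\<lambda>t. M - c * t < N) (at s within {0<..<1})"
    using N(1) by (intro order_tendstoD(2)) auto
  moreover have "eventually (\<lambda>t. t \<in> {0<..<1}) (at s within {0<..<1})"
    by (simp add: eventually_at_filter)
  ultimately have "eventually (\<lambda>t. dist (exp t) (exp s) < \<epsilon> \<and> M - c * t < N \<and> t \<in> {0<..<1})
      (at s within {0<..<1})"
    by eventually_elim simp
  then obtain t where t: "\<bar>exp t - exp s\<bar> < \<epsilon>" "M - c * t < N" "t \<in> {0<..<1}"
    using eventually_happens'[OF nt] by (auto simp: dist_real_def)
  have ann: "of_real (exp t) \<in> annS" using t(3) exp_in_annS_iff by blast
  obtain \<theta> where \<theta>: "\<theta> \<in> sphere 0 1"
    and eq: "rotation_sup \<Phi> (z, of_real (exp t)) = \<Phi> (z, \<theta> * of_real (exp t))"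
    using rotation_sup_attained[OF psh z ann] by blast
  have "radial_inf c (rotation_sup \<Phi>) z \<le> rotation_sup \<Phi> (z, of_real (exp t)) + ereal (- c * t)"
    unfolding radial_inf_def by (rule INF_lower[OF t(3)])
  also have "\<dots> \<le> ereal M + ereal (- c * t)"
    unfolding eq using \<epsilon>(2)[OF rotation_in_annS[OF \<theta> ann]] \<theta> t(1)
    by (intro add_mono) (auto simp: norm_mult)
  also have "\<dots> \<le> ereal N" using t(2) by simp
  finally show "radial_inf c (rotation_sup \<Phi>) z \<le> M'" using N(2) by simp
qed

text \<open>Here \<open>c\<close> is the slope of a supporting line at \<open>t0\<close>, so that
  \<open>t0\<close> itself minimises \<open>\<Psi> - c * t\<close>. Such a line exists because a
  convex function finite at one interior point is nowhere minus infinity on the interval.\<close>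

lemma radial_le_radial_inf:
  assumes psh: "psh2 \<Psi> (D \<times> annS)" and rot: "rotation_invariant D \<Psi>" and z: "z \<in> D"
    and t0: "t0 \<in> {0<..<1}"
  shows "\<exists>c. \<Psi> (z, of_real (exp t0)) \<le> radial_inf c \<Psi> z + ereal (c * t0)"
proof -
  define f where "f = (\<lambda>t. \<Psi> (z, of_real (exp t)))"
  have less: "f t < \<infinity>" if "t \<in> {0<..<1}" for t
    using psh2_less_PInf[OF psh] z exp_in_annS_iff that unfolding f_def by blast
  have conv: "f t \<le> ereal (A1 + (A2 - A1) / (t2 - t1) * (t - t1))"
    if "t1 \<in> {0<..<1}" "t2 \<in> {0<..<1}" "t1 < t2" "t1 \<le> t" "t \<le> t2" "f t1 \<le> ereal A1" "f t2 \<le> ereal A2"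
    for t1 t2 t A1 A2
    using psh2_log_convex[OF psh rot z] that unfolding f_def by auto
  show ?thesis
  proof (cases "f t0 = -\<infinity>")
    case True
    then show ?thesis by (simp add: f_def)
  next
    case False
    then obtain k0 where k0: "f t0 = ereal k0" using less[OF t0] by (cases "f t0") auto
    have "f t \<noteq> -\<infinity>" if t: "t \<in> {0<..<1}" for t
    proof
      assume inf: "f t = -\<infinity>"
      \<comment> \<open>Past \<open>t0\<close>, on the side away from \<open>t\<close>, pick a point; convexity would then push
        \<open>f t0\<close> below every real.\<close>
      have ne: "t \<noteq> t0" using inf k0 by auto
      define t' where "t' = (if t < t0 then (t0 + 1) / 2 else t0 / 2)"
      have t': "t' \<in> {0<..<1}" using t0 by (auto simp: t'_def)
      obtain B where B: "f t' \<le> ereal B" using less[OF t'] by (cases "f t'") auto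
      define l where "l = (t0 - t') / (t - t')"
      have l: "0 < l" using ne t0 by (auto simp: l_def t'_def field_simps)
      have *: "k0 \<le> B + (A - B) * l" for A
      proof (cases "t < t0")
        case True
        then have lt: "t < t0" "t0 < t'" using t0 by (auto simp: t'_def)
        have "k0 \<le> A + (B - A) / (t' - t) * (t0 - t)"
          using conv[of t t' t0 A B] lt t t' inf B k0 by simp
        also have "\<dots> = B + (A - B) * l" using lt by (simp add: l_def divide_simps) (simp add: algebra_simps)
        finally show ?thesis .
      next
        case False
        then have lt: "t' < t0" "t0 < t" using t0 ne by (auto simp: t'_def)
        have "k0 \<le> B + (A - B) / (t - t') * (t0 - t')"
          using conv[of t' t t0 B A] lt t t' inf B k0 by simp
        then show ?thesis by (simp add: l_def)
      qed
      \<comment> \<open>This choice of \<open>A\<close> turns the right-hand side into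
        \<open>k0 - 1\<close>.\<close>
      from *[of "B + (k0 - B - 1) / l"] show False using l by simp
    qed
    then have real: "f t = ereal (real_of_ereal (f t))" if "t \<in> {0<..<1}" for t
      using less[OF that] that by (cases "f t") auto
    define k where "k = (\<lambda>t. real_of_ereal (f t))"
    have fk: "f t = ereal (k t)" if "t \<in> {0<..<1}" for t using real[OF that] by (simp add: k_def)
    have "convex_on {0<..<1} k"
    proof (rule convex_on_linorderI)
      fix l x y :: real assume l: "0 < l" "l < 1" and xy: "x \<in> {0<..<1}" "y \<in> {0<..<1}" "x < y"
      define t where "t = (1 - l) *\<^sub>R x + l *\<^sub>R y"
      have t_eq: "t = x + l * (y - x)" by (simp add: t_def algebra_simps)
      have "0 \<le> l * (y - x)" "l * (y - x) \<le> 1 * (y - x)"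
        using l xy(3) by (auto intro!: mult_right_mono)
      then have t: "x \<le> t" "t \<le> y" unfolding t_eq by auto
      then have "k t \<le> k x + (k y - k x) / (y - x) * (t - x)"
        using conv[of x y t "k x" "k y"] xy fk[of x] fk[of y] fk[of t] by simp
      also have "(k y - k x) / (y - x) * (t - x) = l * (k y - k x)"
        using xy(3) by (simp add: t_eq)
      also have "k x + l * (k y - k x) = (1 - l) * k x + l * k y" by (simp add: algebra_simps)
      finally show "k ((1 - l) *\<^sub>R x + l *\<^sub>R y) \<le> (1 - l) * k x + l * k y" by (simp add: t_def)
    qed simp
    from convex_le_Inf_differential[OF this] t0
    obtain c where c: "\<And>t. t \<in> {0<..<1} \<Longrightarrow> k t0 + c * (t - t0) \<le> k t" by force
    have "ereal (k t0 - c * t0) \<le> radial_inf c \<Psi> z"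
      unfolding radial_inf_def
    proof (rule INF_greatest)
      fix t :: real assume t: "t \<in> {0<..<1}"
      show "ereal (k t0 - c * t0) \<le> \<Psi> (z, of_real (exp t)) + ereal (- c * t)"
        using c[OF t] fk[OF t] by (simp add: f_def algebra_simps)
    qed
    then have "ereal (k t0 - c * t0) + ereal (c * t0) \<le> radial_inf c \<Psi> z + ereal (c * t0)"
      by (rule add_right_mono)
    then show ?thesis using fk[OF t0] by (auto simp: f_def)
  qed
qed

text \<open>The function \<open>W\<close> is a competitor in both envelopes \<open>g_env\<close>,
  hence lies below both and competes in \<open>P_env\<close>; at the chosen point it dominates
  \<open>\<Phi>\<close> through the supporting line of slope \<open>c\<close>.\<close>

lemma le_P_env_of_bdry_cond:
  fixes D :: "(complex^'n) set"
  assumes D: "open D" and u0: "u0 \<in> PSHneg D" and u1: "u1 \<in> PSHneg D"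
    and \<Phi>: "\<Phi> \<in> PSHneg2 (D \<times> annS)" and bc: "bdry_cond D u0 u1 \<Phi>"
    and z: "z \<in> D" and \<zeta>: "\<zeta> \<in> annS"
  shows "\<Phi> (z, \<zeta>) \<le> P_env D (g_env D u0) (g_env D u1) z"
proof -
  have psh\<Phi>: "psh2 \<Phi> (D \<times> annS)" and neg\<Phi>: "\<And>p. p \<in> D \<times> annS \<Longrightarrow> \<Phi> p \<le> 0"
    using \<Phi> by (auto simp: PSHneg2_def)
  define \<Psi> where "\<Psi> = rotation_sup \<Phi>"
  have psh: "psh2 \<Psi> (D \<times> annS)" unfolding \<Psi>_def by (rule psh2_rotation_sup[OF psh\<Phi>])
  have rot: "rotation_invariant D \<Psi>"
    unfolding rotation_invariant_def \<Psi>_def by (intro ballI impI rotation_sup_cong)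
  have neg: "\<Psi> p \<le> 0" if "p \<in> D \<times> annS" for p
    unfolding \<Psi>_def rotation_sup_def using that rotation_in_annS
    by (intro SUP_least neg\<Phi>) auto
  define t where "t = ln (cmod \<zeta>)"
  have exp_t: "exp t = cmod \<zeta>" using annS_nonzero[OF \<zeta>] by (simp add: t_def)
  have ann: "of_real (exp t) \<in> annS" using \<zeta> unfolding exp_t by (simp add: annS_def)
  then have t: "t \<in> {0<..<1}" by (simp add: exp_in_annS_iff)
  obtain c where c: "\<Psi> (z, of_real (exp t)) \<le> radial_inf c \<Psi> z + ereal (c * t)"
    using radial_le_radial_inf[OF psh rot z t] by blast
  have neg0: "u0 y \<le> 0" and neg1: "u1 y \<le> 0" if "y \<in> D" for y
    using u0 u1 that by (auto simp: PSHneg_def)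
  have le0: "radial_inf c \<Psi> y \<le> u0 y" if y: "y \<in> D" for y
    using radial_inf_le_boundary[OF psh\<Phi> y, of 0 u0 c] bc y
    by (auto simp: bdry_cond_def S0_def \<Psi>_def zero_ereal_def[symmetric])
  have le1: "radial_inf c \<Psi> y \<le> u1 y + ereal (- c)" if y: "y \<in> D" for y
    using radial_inf_le_boundary[OF psh\<Phi> y, of 1 u1 c] bc y
    by (auto simp: bdry_cond_def S1_def \<Psi>_def)
  \<comment> \<open>Of the two constants \<open>m\<close> and \<open>m - c\<close>, both
    nonnegative, one is zero, which yields \<open>W \<le> 0\<close>; moreover
    \<open>c * t \<le> m\<close> for \<open>t\<close> between 0 and 1.\<close>
  define m where "m = max c 0"
  define W where "W = (\<lambda>y. radial_inf c \<Psi> y + ereal m)"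
  have pshW: "psh W D"
    unfolding W_def by (intro psh_add_const psh_radial_inf psh D rot neg)
  have W0: "W y \<le> u0 y + ereal m" if "y \<in> D" for y
    unfolding W_def using le0[OF that] by (rule add_right_mono)
  have W1: "W y \<le> u1 y + ereal (m - c)" if "y \<in> D" for y
    using add_right_mono[OF le1[OF that], of "ereal m"] unfolding W_def
    by (simp add: add.assoc)
  have "W y \<le> 0" if y: "y \<in> D" for y
  proof (cases "0 \<le> c")
    case True
    then show ?thesis using W1[OF y] neg1[OF y] by (simp add: m_def zero_ereal_def[symmetric])
  next
    case False
    then show ?thesis using W0[OF y] neg0[OF y] by (simp add: m_def zero_ereal_def[symmetric])
  qed
  then have W: "W \<in> PSHneg D" using pshW by (simp add: PSHneg_def)
  have "\<Phi> (z, \<zeta>) \<le> \<Psi> (z, of_real (exp t))"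
    using rotation_sup_ge[of \<Phi> z \<zeta>] rotation_sup_cong[of \<zeta> "of_real (exp t)" \<Phi> z] exp_t
    by (simp add: \<Psi>_def)
  also note c
  also have "radial_inf c \<Psi> z + ereal (c * t) \<le> W z"
  proof -
    have "c * t \<le> m"
      using t mult_left_le[of t c] by (cases "0 \<le> c") (auto simp: m_def mult_nonpos_nonneg)
    then show ?thesis unfolding W_def by (intro add_left_mono) simp
  qed
  also have "W z \<le> P_env D (g_env D u0) (g_env D u1) z"
    by (rule le_P_env[OF pshW le_g_env[OF W W0] le_g_env[OF W W1]])
  finally show ?thesis .
qed

text \<open>When the obstacles agree on \<open>D\<close> with the upper semicontinuous
  \<open>u0\<close> and \<open>u1\<close>, regularization keeps \<open>P\<close> below them. The
  same semicontinuity bounds its limsup at the boundary circles, and independence of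
  \<open>\<zeta>\<close> transfers plurisubharmonicity to the product.\<close>

lemma P_env_PSHneg2_and_bdry_cond:
  fixes D :: "(complex^'n) set"
  assumes D: "open D" and u0: "u0 \<in> PSHneg D" and u1: "u1 \<in> PSHneg D"
    and g0: "\<And>z. z \<in> D \<Longrightarrow> g0 z = u0 z" and g1: "\<And>z. z \<in> D \<Longrightarrow> g1 z = u1 z"
  shows "(\<lambda>(z, \<zeta>). P_env D g0 g1 z) \<in> PSHneg2 (D \<times> annS)"
    and "bdry_cond D u0 u1 (\<lambda>(z, \<zeta>). P_env D g0 g1 z)"
proof -
  define P where "P = P_env D g0 g1"
  define F where "F = {w. psh w D \<and> (\<forall>y\<in>D. w y \<le> min (g0 y) (g1 y))}"
  have P: "P = (\<lambda>z. Limsup (nhds z) (\<lambda>x. SUP w\<in>F. w x))"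
    unfolding P_def P_env_def F_def by (auto simp: fun_eq_iff image_def intro!: arg_cong[of _ _ Sup] arg_cong2[of _ _ _ _ Limsup])
  have usc0: "usc_on D u0" and usc1: "usc_on D u1"
    using u0 u1 psh_usc by (auto simp: PSHneg_def)
  have P0: "P z \<le> u0 z" and P1: "P z \<le> u1 z" if z: "z \<in> D" for z
    unfolding P
    by (rule Limsup_nhds_le_usc[OF D _ z]; use usc0 usc1 g0 g1 in \<open>auto simp: F_def intro!: SUP_least\<close>)+
  have neg: "P z \<le> 0" if "z \<in> D" for z
    using P0[OF that] u0 that unfolding PSHneg_def by fastforce
  have pshP: "psh P D"
    unfolding P
  proof (rule psh_regularized_Sup[OF D])
    show "Limsup (nhds z) (\<lambda>x. SUP w\<in>F. w x) < \<infinity>" if "z \<in> D" for z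
      using neg[OF that] unfolding P by auto
  qed (simp add: F_def)
  have eq: "(\<lambda>(z, \<zeta>). P_env D g0 g1 z) = (\<lambda>p. P (fst p))" by (auto simp: P_def)
  have "psh2 (\<lambda>p. P (fst p)) (D \<times> annS)"
  proof (rule psh2I)
    show "usc_on (D \<times> annS) (\<lambda>p. P (fst p))"
      by (rule usc_on_compose[OF psh_usc[OF pshP]]) (auto intro: continuous_intros)
    show "P (fst p) < \<infinity>" if "p \<in> D \<times> annS" for p using neg[of "fst p"] that by auto
  next
    fix z0 a :: "complex^'n" and \<zeta>0 b w0 r h
    assume "(z0, \<zeta>0) \<in> D \<times> annS" "0 < r"
      "\<And>w. w \<in> cball w0 r \<Longrightarrow> (z0 + w *s a, \<zeta>0 + w * b) \<in> D \<times> annS"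
      "continuous_on (sphere w0 r) h"
      "\<And>w. w \<in> sphere w0 r \<Longrightarrow> P (fst (z0 + w *s a, \<zeta>0 + w * b)) \<le> ereal (h w)"
    then show "P (fst (z0 + w0 *s a, \<zeta>0 + w0 * b)) \<le>
        ereal (1 / (2*pi) * integral {0..2*pi} (\<lambda>t. h (w0 + complex_of_real r * cis t)))"
      using psh_gen_submean[OF pshP[unfolded psh_def], of z0 r w0 a h] by simp
  qed (intro open_Times D open_annS)
  then show "(\<lambda>(z, \<zeta>). P_env D g0 g1 z) \<in> PSHneg2 (D \<times> annS)"
    unfolding eq PSHneg2_def using neg by auto
  have bd: "Limsup (at (z, \<zeta>) within D \<times> annS) (\<lambda>p. P (fst p)) \<le> u z"
    if z: "z \<in> D" and u: "usc_on D u" "\<And>x. x \<in> D \<Longrightarrow> P x \<le> u x" for z \<zeta> u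
    unfolding Limsup_le_iff
  proof (intro allI impI)
    fix y assume "u z < y"
    then have "open ({x\<in>D. u x < y} \<times> (UNIV :: complex set))" "(z, \<zeta>) \<in> {x\<in>D. u x < y} \<times> UNIV"
      using z by (auto intro!: open_Times usc_on_openD[OF u(1) D])
    then have "eventually (\<lambda>p. p \<in> {x\<in>D. u x < y} \<times> UNIV) (at (z, \<zeta>) within D \<times> annS)"
      using eventually_nhds_in_open unfolding eventually_at_filter by (blast intro: eventually_mono)
    then show "eventually (\<lambda>p. P (fst p) < y) (at (z, \<zeta>) within D \<times> annS)"
      by eventually_elim (use u(2) le_less_trans in fastforce)
  qed
  show "bdry_cond D u0 u1 (\<lambda>(z, \<zeta>). P_env D g0 g1 z)"
    unfolding eq bdry_cond_def using bd[OF _ usc0 P0] bd[OF _ usc1 P1] by simp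
qed

text \<open>Being the largest is expressed by two facts: the first conjunct bounds every competitor
  by \<open>P\<close>, and the second makes \<open>P\<close> a competitor.\<close>

theorem theorem6p2:
  fixes D :: "(complex^'n) set" and u0 u1 :: "complex^'n \<Rightarrow> ereal"
  assumes hD: "hyperconvex D"
    and u0: "u0 \<in> PSHneg D" and u1: "u1 \<in> PSHneg D"
    and A0: "closedin (top_of_set D) (pole_set D u0)"
    and A1: "closedin (top_of_set D) (pole_set D u1)"
    and lb0: "locally_bounded_on (D - pole_set D u0) u0"
    and lb1: "locally_bounded_on (D - pole_set D u1) u1"
  shows "(\<forall>\<Phi>. \<Phi> \<in> PSHneg2 (D \<times> annS) \<and> bdry_cond D u0 u1 \<Phi> \<longrightarrow>
            (\<forall>z\<in>D. \<forall>\<zeta>\<in>annS. \<Phi> (z, \<zeta>) \<le> P_env D (g_env D u0) (g_env D u1) z))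
       \<and> ((\<forall>z\<in>D. g_env D u0 z = u0 z) \<and> (\<forall>z\<in>D. g_env D u1 z = u1 z) \<longrightarrow>
            (\<lambda>(z, \<zeta>). P_env D (g_env D u0) (g_env D u1) z) \<in> PSHneg2 (D \<times> annS) \<and>
            bdry_cond D u0 u1 (\<lambda>(z, \<zeta>). P_env D (g_env D u0) (g_env D u1) z))"
proof -
  have "open D" using hD by (simp add: hyperconvex_def)
  then show ?thesis
    using le_P_env_of_bdry_cond[OF _ u0 u1] P_env_PSHneg2_and_bdry_cond[OF _ u0 u1] by blast
qed

end
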